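(* Let $G$ be a groupoid and let $A$ be a localizable completion of the convolution algebra $C_c(G)$ of the trivial Fell line bundle on $G$. If the associated map $p:\operatorname{Max}A\to\Omega(G)$ is a stable quantic bundle then $G$ is a Hausdorff principal groupoid.
   Context: Groupoids. A groupoid $G$ is a topological groupoid with unit space $G_0\subset G$, $d(g)=g^{-1}g$, $r(g)=gg^{-1}$. Every groupoid is assumed étale ($d$ is a local homeomorphism) with $G_0$ locally compact Hausdorff; $G$ is not assumed Hausdorff. A local bisection is an open $U\subset G$ on which $d$ and $r$ are injective; $\mathcal I(G)$ is the set of local bisections. $G$ is principal if $\{g:d(g)=r(g)=x\}=\{x\}$ for all $x\in G_0$. Quantales. An involutive quantale is a complete lattice with an associative product distributing over arbitrary joins on both sides and a join-preserving involution with $(ab)^*=b^*a^*$. A map $p:Q\to X$ of involutive quantales is a map $p^*:X\to Q$ preserving arbitrary joins, products and involution; $p$ is a surjection if $p^*$ is injective, and semiopen if $p^*$ has a left adjoint $p_!:Q\to X$ ($p_!(a)\le x\iff a\le p^*(x)$). $\Omega(G)$, the topology of $G$, is an involutive quantale under pointwise product and $U\mapsto U^{-1}$. $\operatorname{Max}A$ is the involutive quantale of closed linear subspaces of a C*-algebra $A$ with inclusion order, pointwise involution, and product $VW=\overline{\operatorname{span}}\{ab:a\in V,b\in W\}$. A map $p:Q\to\Omega(G)$ is a stable quantic bundle if it is semiopen, surjective, and $p_!(a\,p^*(U)\,b)=p_!(a)\,U\,p_!(b)$ for all $U\in\Omega(G)$ and all $a,b\in Q$. Convolution algebra. For a Hausdorff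 open $U\subset G$, $C_c(U)$ is the space of functions $s:G\to\mathbb C$ (not necessarily continuous on $G$) that vanish outside $U$, are continuous on $U$, and satisfy $\{g:s(g)\ne0\}\subset K\subset U$ for some compact $K$. The convolution algebra, here denoted $C_c(G)$, is the linear span of $\bigcup_{U\in\mathcal I(G)}C_c(U)$ (if $G$ is Hausdorff this is the usual space of continuous compactly supported functions), a $*$-algebra with $st(g)=\sum_{g=hk}s(h)t(k)$ and $s^*(g)=\overline{s(g^{-1})}$. Let $\|s\|_\infty=\sup_g|s(g)|$. A compatible norm is a C*-norm $\|\cdot\|$ on it with $\|s\|_\infty\le\|s\|$ for all $s$ and $\|s\|_\infty=\|s\|$ if $s\in C_c(U)$ for some $U\in\mathcal I(G)$; the C*-completion $A$ in it is a compatible completion. For $g\in G$, $s\mapsto s(g)$ extends to a continuous linear map $\operatorname{eval}_g:A\to\mathbb C$. The associated map $p:\operatorname{Max}A\to\Omega(G)$ of involutive quantales is given by $p^*(V)=\overline{\operatorname{span}}\bigcup\{C_c(U):U\in\mathcal I(G),\ U\subset V\}$. Localizability. For $a\in A$ let $\sigma(\langle a\rangle)=\operatorname{int}\{g\in G:\operatorname{eval}_g(a)\ne0\}$, and for $V\in\Omega(G)$ let $\gamma(V)=\overline{\operatorname{span}}\{a\in A:\sigma(\langle a\rangle)\subset V\}$. A localizable completion is a compatible completion $A$ with $p^*=\gamma$; then $p$ is semiopen with $p_!(V)=\bigcup_{a\in V}\operatorname{int}\{g:\operatorname{eval}_g(a)\neq0\}$. *)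

theory Defs
  imports "HOL-Analysis.Analysis" "HOL-Library.Function_Algebras" "HOL-Algebra.Complete_Lattice"
begin

section \<open>Etale groupoids\<close>

record 'g groupoid =
  topo :: "'g topology"
  gmult :: "'g \<Rightarrow> 'g \<Rightarrow> 'g"
  ginv :: "'g \<Rightarrow> 'g"

text \<open>The arrows are the points of the topology. The product is a total function of the logic,
  but only its values on composable pairs matter.\<close>

abbreviation arrows :: "'g groupoid \<Rightarrow> 'g set" where
  "arrows G \<equiv> topspace (topo G)"

definition gdom :: "'g groupoid \<Rightarrow> 'g \<Rightarrow> 'g" where
  "gdom G g = gmult G (ginv G g) g"

definition grng :: "'g groupoid \<Rightarrow> 'g \<Rightarrow> 'g" where
  "grng G g = gmult G g (ginv G g)"

definition units :: "'g groupoid \<Rightarrow> 'g set" where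
  "units G = gdom G ` arrows G"

definition composable :: "'g groupoid \<Rightarrow> ('g \<times> 'g) set" where
  "composable G = {(g, h). g \<in> arrows G \<and> h \<in> arrows G \<and> gdom G g = grng G h}"

locale topological_groupoid =
  fixes G :: "'g groupoid"
  assumes inv_closed: "g \<in> arrows G \<Longrightarrow> ginv G g \<in> arrows G"
    and mult_closed: "(g, h) \<in> composable G \<Longrightarrow> gmult G g h \<in> arrows G"
    and dom_inv: "g \<in> arrows G \<Longrightarrow> gdom G (ginv G g) = grng G g"
    and rng_inv: "g \<in> arrows G \<Longrightarrow> grng G (ginv G g) = gdom G g"
    and dom_mult: "(g, h) \<in> composable G \<Longrightarrow> gdom G (gmult G g h) = gdom G h"
    and rng_mult: "(g, h) \<in> composable G \<Longrightarrow> grng G (gmult G g h) = grng G g"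
    and mult_assoc: "(g, h) \<in> composable G \<Longrightarrow> (h, k) \<in> composable G \<Longrightarrow>
          gmult G (gmult G g h) k = gmult G g (gmult G h k)"
    and mult_dom: "g \<in> arrows G \<Longrightarrow> gmult G g (gdom G g) = g"
    and rng_mult_self: "g \<in> arrows G \<Longrightarrow> gmult G (grng G g) g = g"
    and continuous_mult:
          "continuous_map (subtopology (prod_topology (topo G) (topo G)) (composable G)) (topo G)
             (\<lambda>(g, h). gmult G g h)"
    and continuous_inv: "continuous_map (topo G) (topo G) (ginv G)"

definition local_homeomorphism :: "'a topology \<Rightarrow> 'b topology \<Rightarrow> ('a \<Rightarrow> 'b) \<Rightarrow> bool" where
  "local_homeomorphism X Y f \<longleftrightarrow>
     (\<forall>x \<in> topspace X. \<exists>U. openin X U \<and> x \<in> U \<and> openin Y (f ` U) \<and>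
        homeomorphic_map (subtopology X U) (subtopology Y (f ` U)) f)"

text \<open>Only the unit space is assumed to be Hausdorff.\<close>

locale etale_groupoid = topological_groupoid +
  assumes etale: "local_homeomorphism (topo G) (subtopology (topo G) (units G)) (gdom G)"
    and Hausdorff_units: "Hausdorff_space (subtopology (topo G) (units G))"
    and locally_compact_units: "locally_compact_space (subtopology (topo G) (units G))"

definition local_bisection :: "'g groupoid \<Rightarrow> 'g set \<Rightarrow> bool" where
  "local_bisection G U \<longleftrightarrow> openin (topo G) U \<and> inj_on (gdom G) U \<and> inj_on (grng G) U"

definition principal_groupoid :: "'g groupoid \<Rightarrow> bool" where
  "principal_groupoid G \<longleftrightarrow>
     (\<forall>x \<in> units G. {g \<in> arrows G. gdom G g = x \<and> grng G g = x} = {x})"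

definition mult_sets :: "'g groupoid \<Rightarrow> 'g set \<Rightarrow> 'g set \<Rightarrow> 'g set" where
  "mult_sets G U V = {gmult G g h | g h. g \<in> U \<and> h \<in> V \<and> (g, h) \<in> composable G}"


section \<open>C*-algebras\<close>

text \<open>Not necessarily unital.\<close>

class cstar_algebra = real_normed_algebra + banach +
  fixes scaleC :: "complex \<Rightarrow> 'a \<Rightarrow> 'a"
    and star :: "'a \<Rightarrow> 'a"
  assumes scaleC_add_right: "scaleC c (x + y) = scaleC c x + scaleC c y"
    and scaleC_add_left: "scaleC (c + d) x = scaleC c x + scaleC d x"
    and scaleC_scaleC: "scaleC c (scaleC d x) = scaleC (c * d) x"
    and scaleC_of_real: "scaleC (complex_of_real r) x = scaleR r x"
    and scaleC_mult_left: "scaleC c x * y = scaleC c (x * y)"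
    and scaleC_mult_right: "x * scaleC c y = scaleC c (x * y)"
    and norm_scaleC: "norm (scaleC c x) = cmod c * norm x"
    and star_add: "star (x + y) = star x + star y"
    and star_scaleC: "star (scaleC c x) = scaleC (cnj c) (star x)"
    and star_mult: "star (x * y) = star y * star x"
    and star_star: "star (star x) = x"
    and cstar_identity: "norm (star x * x) = (norm x)\<^sup>2"

global_interpretation cspace: vector_space "scaleC :: complex \<Rightarrow> 'a \<Rightarrow> 'a::cstar_algebra"
  defines csubspace = cspace.subspace
    and cspan = cspace.span
proof
  fix c d and x y :: 'a
  show "scaleC 1 x = x"
    using scaleC_of_real[of 1 x] by simp
qed (simp_all add: scaleC_add_right scaleC_add_left scaleC_scaleC)

definition closed_cspan :: "'a::cstar_algebra set \<Rightarrow> 'a set" where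
  "closed_cspan S = closure (cspan S)"


section \<open>Involutive quantales\<close>

record 'q quantale_struct = "'q gorder" +
  qmult :: "'q \<Rightarrow> 'q \<Rightarrow> 'q"
  qinv :: "'q \<Rightarrow> 'q"

locale involutive_quantale = complete_lattice Q for Q :: "'q quantale_struct" (structure) +
  assumes qmult_closed: "a \<in> carrier Q \<Longrightarrow> b \<in> carrier Q \<Longrightarrow> qmult Q a b \<in> carrier Q"
    and qinv_closed: "a \<in> carrier Q \<Longrightarrow> qinv Q a \<in> carrier Q"
    and qmult_assoc: "a \<in> carrier Q \<Longrightarrow> b \<in> carrier Q \<Longrightarrow> c \<in> carrier Q \<Longrightarrow>
          qmult Q (qmult Q a b) c = qmult Q a (qmult Q b c)"
    and qmult_Sup: "a \<in> carrier Q \<Longrightarrow> S \<subseteq> carrier Q \<Longrightarrow> qmult Q a (\<Squnion>S) = \<Squnion>(qmult Q a ` S)"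
    and Sup_qmult: "a \<in> carrier Q \<Longrightarrow> S \<subseteq> carrier Q \<Longrightarrow>
          qmult Q (\<Squnion>S) a = \<Squnion>((\<lambda>b. qmult Q b a) ` S)"
    and qinv_qinv: "a \<in> carrier Q \<Longrightarrow> qinv Q (qinv Q a) = a"
    and qinv_qmult: "a \<in> carrier Q \<Longrightarrow> b \<in> carrier Q \<Longrightarrow>
          qinv Q (qmult Q a b) = qmult Q (qinv Q b) (qinv Q a)"
    and qinv_Sup: "S \<subseteq> carrier Q \<Longrightarrow> qinv Q (\<Squnion>S) = \<Squnion>(qinv Q ` S)"

text \<open>A map \<open>p\<close> from \<open>Q\<close> to \<open>X\<close> is given by its inverse image
  homomorphism \<open>p\<^sup>*\<close> from \<open>X\<close> to \<open>Q\<close>, here \<open>ps\<close>.\<close>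

locale quantale_map =
  Q: involutive_quantale Q + X: involutive_quantale X
  for Q :: "'q quantale_struct" and X :: "'x quantale_struct" +
  fixes ps :: "'x \<Rightarrow> 'q"
  assumes map_closed: "ps \<in> carrier X \<rightarrow> carrier Q"
    and map_Sup: "S \<subseteq> carrier X \<Longrightarrow> ps (\<Squnion>\<^bsub>X\<^esub>S) = \<Squnion>\<^bsub>Q\<^esub>(ps ` S)"
    and map_qmult: "x \<in> carrier X \<Longrightarrow> y \<in> carrier X \<Longrightarrow>
          ps (qmult X x y) = qmult Q (ps x) (ps y)"
    and map_qinv: "x \<in> carrier X \<Longrightarrow> ps (qinv X x) = qinv Q (ps x)"

definition left_adjoint ::
    "'q quantale_struct \<Rightarrow> 'x quantale_struct \<Rightarrow> ('x \<Rightarrow> 'q) \<Rightarrow> ('q \<Rightarrow> 'x) \<Rightarrow> bool" where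
  "left_adjoint Q X ps pl \<longleftrightarrow> pl \<in> carrier Q \<rightarrow> carrier X \<and>
     (\<forall>a \<in> carrier Q. \<forall>x \<in> carrier X. pl a \<sqsubseteq>\<^bsub>X\<^esub> x \<longleftrightarrow> a \<sqsubseteq>\<^bsub>Q\<^esub> ps x)"

definition semiopen_map ::
    "'q quantale_struct \<Rightarrow> 'x quantale_struct \<Rightarrow> ('x \<Rightarrow> 'q) \<Rightarrow> bool" where
  "semiopen_map Q X ps \<longleftrightarrow> (\<exists>pl. left_adjoint Q X ps pl)"

definition surjection_map :: "'x quantale_struct \<Rightarrow> ('x \<Rightarrow> 'q) \<Rightarrow> bool" where
  "surjection_map X ps \<longleftrightarrow> inj_on ps (carrier X)"

definition Omega :: "'g groupoid \<Rightarrow> 'g set quantale_struct" where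
  "Omega G = \<lparr>carrier = {U. openin (topo G) U}, eq = (=), le = (\<subseteq>),
     qmult = mult_sets G, qinv = (\<lambda>U. ginv G ` U)\<rparr>"

definition Max_quantale :: "'a::cstar_algebra set quantale_struct" where
  "Max_quantale = \<lparr>carrier = {V. csubspace V \<and> closed V}, eq = (=), le = (\<subseteq>),
     qmult = (\<lambda>V W. closed_cspan {a * b | a b. a \<in> V \<and> b \<in> W}), qinv = (\<lambda>V. star ` V)\<rparr>"

text \<open>Both structures are involutive quantales.\<close>
lemma involutive_quantaleI:
  fixes Q :: "'a set quantale_struct"
  assumes eq: "eq Q = (=)" and le: "le Q = (\<subseteq>)"
    and J: "\<And>S. S \<subseteq> carrier Q \<Longrightarrow> J S \<in> carrier Q"
    and J_least: "\<And>S x. S \<subseteq> carrier Q \<Longrightarrow> x \<in> carrier Q \<Longrightarrow> J S \<subseteq> x \<longleftrightarrow> (\<forall>y\<in>S. y \<subseteq> x)"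
    and mc: "\<And>a b. a \<in> carrier Q \<Longrightarrow> b \<in> carrier Q \<Longrightarrow> qmult Q a b \<in> carrier Q"
    and ic: "\<And>a. a \<in> carrier Q \<Longrightarrow> qinv Q a \<in> carrier Q"
    and assoc: "\<And>a b c. a \<in> carrier Q \<Longrightarrow> b \<in> carrier Q \<Longrightarrow> c \<in> carrier Q \<Longrightarrow>
          qmult Q (qmult Q a b) c = qmult Q a (qmult Q b c)"
    and d1: "\<And>a S. a \<in> carrier Q \<Longrightarrow> S \<subseteq> carrier Q \<Longrightarrow> qmult Q a (J S) = J (qmult Q a ` S)"
    and d2: "\<And>a S. a \<in> carrier Q \<Longrightarrow> S \<subseteq> carrier Q \<Longrightarrow>
          qmult Q (J S) a = J ((\<lambda>b. qmult Q b a) ` S)"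
    and ii: "\<And>a. a \<in> carrier Q \<Longrightarrow> qinv Q (qinv Q a) = a"
    and im: "\<And>a b. a \<in> carrier Q \<Longrightarrow> b \<in> carrier Q \<Longrightarrow>
          qinv Q (qmult Q a b) = qmult Q (qinv Q b) (qinv Q a)"
    and iS: "\<And>S. S \<subseteq> carrier Q \<Longrightarrow> qinv Q (J S) = J (qinv Q ` S)"
  shows "involutive_quantale Q" and "S \<subseteq> carrier Q \<Longrightarrow> \<Squnion>\<^bsub>Q\<^esub>S = J S"
proof -
  interpret partial_order Q
    by unfold_locales (auto simp: eq le)
  have J1: "least Q (J S) (Upper Q S)" if "S \<subseteq> carrier Q" for S
  proof (rule least_UpperI)
    show "x \<sqsubseteq>\<^bsub>Q\<^esub> J S" if "x \<in> S" for x
      using J_least[OF \<open>S \<subseteq> carrier Q\<close> J[OF \<open>S \<subseteq> carrier Q\<close>]] that unfolding le by blast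
    show "J S \<sqsubseteq>\<^bsub>Q\<^esub> y" if "y \<in> Upper Q S" for y
      using J_least[OF \<open>S \<subseteq> carrier Q\<close>] \<open>S \<subseteq> carrier Q\<close> that by (auto simp: le Upper_def)
  qed (use that J in auto)
  have inf: "\<exists>i. greatest Q i (Lower Q S)" if S: "S \<subseteq> carrier Q" for S
  proof -
    have L: "Lower Q S \<subseteq> carrier Q" by auto
    have "greatest Q (J (Lower Q S)) (Lower Q S)"
    proof (rule greatest_LowerI)
      show "J (Lower Q S) \<sqsubseteq>\<^bsub>Q\<^esub> x" if "x \<in> S" for x
        using J_least[OF L, of x] that S by (auto simp: le Lower_def)
      show "y \<sqsubseteq>\<^bsub>Q\<^esub> J (Lower Q S)" if "y \<in> Lower Q S" for y
        using J_least[OF L J[OF L]] that unfolding le by blast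
    qed (use S J L in auto)
    then show ?thesis ..
  qed
  interpret complete_lattice Q
    using J1 inf by unfold_locales blast+
  have Sup: "\<Squnion>\<^bsub>Q\<^esub>S = J S" if "S \<subseteq> carrier Q" for S
    using J1[OF that] sup_lub[OF that] least_unique by auto
  then show "S \<subseteq> carrier Q \<Longrightarrow> \<Squnion>\<^bsub>Q\<^esub>S = J S" .
  show "involutive_quantale Q"
  proof
    fix a S assume "a \<in> carrier Q" "S \<subseteq> carrier Q"
    then show "qmult Q a (\<Squnion>\<^bsub>Q\<^esub>S) = \<Squnion>\<^bsub>Q\<^esub>(qmult Q a ` S)"
      using mc by (subst (1 2) Sup) (auto simp: d1)
  next
    fix a S assume "a \<in> carrier Q" "S \<subseteq> carrier Q"
    then show "qmult Q (\<Squnion>\<^bsub>Q\<^esub>S) a = \<Squnion>\<^bsub>Q\<^esub>((\<lambda>b. qmult Q b a) ` S)"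
      using mc by (subst (1 2) Sup) (auto simp: d2)
  next
    fix S assume "S \<subseteq> carrier Q"
    then show "qinv Q (\<Squnion>\<^bsub>Q\<^esub>S) = \<Squnion>\<^bsub>Q\<^esub>(qinv Q ` S)"
      using ic by (subst (1 2) Sup) (auto simp: iS)
  qed (use mc ic assoc ii im in auto)
qed

context topological_groupoid
begin

lemma inv_inv: "g \<in> arrows G \<Longrightarrow> ginv G (ginv G g) = g"
proof -
  assume g: "g \<in> arrows G"
  let ?i = "ginv G g"
  have i: "?i \<in> arrows G" "ginv G ?i \<in> arrows G" using g inv_closed by auto
  have c: "(ginv G ?i, ?i) \<in> composable G" "(?i, g) \<in> composable G"
    using g i dom_inv by (auto simp: composable_def)
  have "ginv G ?i = gmult G (ginv G ?i) (gdom G (ginv G ?i))"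
    using i mult_dom by simp
  also have "gdom G (ginv G ?i) = gmult G ?i g"
    using g i dom_inv rng_inv by (simp add: gdom_def)
  also have "gmult G (ginv G ?i) (gmult G ?i g) = gmult G (gmult G (ginv G ?i) ?i) g"
    using mult_assoc[OF c] by simp
  also have "gmult G (ginv G ?i) ?i = grng G g"
    using dom_inv[OF g] by (simp add: gdom_def)
  also have "gmult G (grng G g) g = g" using g rng_mult_self by simp
  finally show ?thesis .
qed

lemma cancel:
  assumes "(g, h) \<in> composable G"
  shows "gmult G (ginv G g) (gmult G g h) = h"
proof -
  have g: "g \<in> arrows G" "h \<in> arrows G" "gdom G g = grng G h"
    using assms by (auto simp: composable_def)
  then have "(ginv G g, g) \<in> composable G"
    using dom_inv inv_closed by (auto simp: composable_def)
  then have "gmult G (ginv G g) (gmult G g h) = gmult G (gdom G g) h"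
    using mult_assoc assms by (simp add: gdom_def)
  then show ?thesis using g rng_mult_self by simp
qed

lemma composable_inv: "(g, h) \<in> composable G \<Longrightarrow> (ginv G h, ginv G g) \<in> composable G"
  using dom_inv rng_inv inv_closed by (auto simp: composable_def)

lemma inv_mult:
  assumes c: "(g, h) \<in> composable G"
  shows "ginv G (gmult G g h) = gmult G (ginv G h) (ginv G g)"
proof -
  let ?k = "gmult G g h"
  have g: "g \<in> arrows G" "h \<in> arrows G" "gdom G g = grng G h" "?k \<in> arrows G"
    using c mult_closed by (auto simp: composable_def)
  have k: "ginv G ?k \<in> arrows G" "gdom G (ginv G ?k) = grng G g" "grng G (ginv G ?k) = gdom G h"
    using g c dom_inv rng_inv dom_mult rng_mult inv_closed by auto
  have c1: "(ginv G ?k, g) \<in> composable G" using k g by (auto simp: composable_def)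
  have c2: "(g, ginv G g) \<in> composable G" 
    using g inv_closed rng_inv by (auto simp: composable_def)
  let ?m = "gmult G (ginv G ?k) g"
  have m: "?m \<in> arrows G" "gdom G ?m = gdom G g" 
    using mult_closed[OF c1] dom_mult[OF c1] by auto
  have c3: "(?m, h) \<in> composable G" using m g by (auto simp: composable_def)
  have c4: "(h, ginv G h) \<in> composable G" 
    using g inv_closed rng_inv by (auto simp: composable_def)
  have mh: "gmult G ?m h = gdom G h"
    using mult_assoc[OF c1 c] dom_mult[OF c] by (simp add: gdom_def)
  have "?m = gmult G ?m (gdom G ?m)" using mult_dom[OF m(1)] by simp
  also have "\<dots> = gmult G ?m (gmult G h (ginv G h))" using m g by (simp add: grng_def)
  also have "\<dots> = gmult G (gdom G h) (ginv G h)" using mult_assoc[OF c3 c4] mh by simp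
  also have "\<dots> = ginv G h" using rng_mult_self[OF inv_closed[OF g(2)]] rng_inv g by simp
  finally have meq: "?m = ginv G h" .
  have "ginv G ?k = gmult G (ginv G ?k) (gdom G (ginv G ?k))" using mult_dom[OF k(1)] by simp
  also have "\<dots> = gmult G (ginv G ?k) (gmult G g (ginv G g))" using k by (simp add: grng_def)
  also have "\<dots> = gmult G ?m (ginv G g)" using mult_assoc[OF c1 c2] by simp
  finally show ?thesis using meq by simp
qed

lemma openin_inv_image:
  assumes "openin (topo G) U"
  shows "openin (topo G) (ginv G ` U)"
proof -
  have "ginv G ` U = {g \<in> arrows G. ginv G g \<in> U}"
  proof safe
    fix g assume "g \<in> U"
    moreover then have "g \<in> arrows G" using openin_subset[OF assms] by auto
    ultimately show "ginv G g \<in> arrows G" "ginv G (ginv G g) \<in> U"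
      using inv_closed inv_inv by auto
  next
    fix g assume "g \<in> arrows G" "ginv G g \<in> U"
    then show "g \<in> ginv G ` U" using inv_inv[of g] by (metis imageI)
  qed
  then show ?thesis
    using openin_continuous_map_preimage[OF continuous_inv assms] by simp
qed

end

lemma (in etale_groupoid) openin_mult_sets:
  assumes U: "openin (topo G) U" and V: "openin (topo G) V"
  shows "openin (topo G) (mult_sets G U V)"
proof (subst openin_subopen, safe)
  fix k0 assume "k0 \<in> mult_sets G U V"
  then obtain g0 h0 where gh: "g0 \<in> U" "h0 \<in> V" "(g0, h0) \<in> composable G" "k0 = gmult G g0 h0"
    by (auto simp: mult_sets_def)
  let ?T = "topo G"
  let ?U0 = "subtopology ?T (units G)"
  have a: "g0 \<in> arrows G" "h0 \<in> arrows G" using gh by (auto simp: composable_def)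
  have inv_hom: "homeomorphic_map ?T ?T (ginv G)"
    by (rule homeomorphic_maps_imp_map[where g = "ginv G"])
      (auto simp: homeomorphic_maps_def continuous_inv inv_inv)
  have cd: "continuous_map ?T ?U0 (gdom G)"
  proof (rule continuous_map_into_subtopology)
    show "continuous_map ?T ?T (gdom G)"
    proof -
      have "continuous_map ?T (subtopology (prod_topology ?T ?T) (composable G)) (\<lambda>g. (ginv G g, g))"
        using continuous_inv
        by (intro continuous_map_into_subtopology)
          (auto simp: continuous_map_pairwise o_def composable_def dom_inv inv_closed)
      from continuous_map_compose[OF this continuous_mult] show ?thesis
        by (simp add: o_def gdom_def[abs_def])
    qed
  qed (auto simp: units_def)
  have cr: "continuous_map ?T ?U0 (grng G)"
    using continuous_map_compose[OF continuous_inv cd]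
    by (rule continuous_map_eq) (auto simp: dom_inv)
  have "ginv G g0 \<in> arrows G" using a inv_closed by auto
  then obtain W where W: "openin ?T W" "ginv G g0 \<in> W" "openin ?U0 (gdom G ` W)"
      "homeomorphic_map (subtopology ?T W) (subtopology ?U0 (gdom G ` W)) (gdom G)"
    using etale unfolding local_homeomorphism_def by blast
  then obtain \<tau> where \<tau>: "homeomorphic_maps (subtopology ?T W) (subtopology ?U0 (gdom G ` W)) (gdom G) \<tau>"
    using homeomorphic_map_maps by blast
  have Wa: "W \<subseteq> arrows G" using openin_subset W by blast
  have dWu: "gdom G ` W \<subseteq> topspace ?U0" using W(3) openin_subset by blast
  have \<tau>c: "continuous_map (subtopology ?U0 (gdom G ` W)) (subtopology ?T W) \<tau>"
    and \<tau>d: "\<And>w. w \<in> W \<Longrightarrow> \<tau> (gdom G w) = w"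
    and d\<tau>: "\<And>x. x \<in> gdom G ` W \<Longrightarrow> gdom G (\<tau> x) = x"
    using \<tau> Wa dWu by (auto simp: homeomorphic_maps_def)
  define D where "D = {k \<in> arrows G. grng G k \<in> gdom G ` W}"
  have D: "openin ?T D"
    unfolding D_def using openin_continuous_map_preimage[OF cr W(3)] .
  have \<tau>W: "\<tau> (grng G k) \<in> W" "gdom G (\<tau> (grng G k)) = grng G k" if "k \<in> D" for k
    using that \<tau>d d\<tau> by (auto simp: D_def)
  have crD: "continuous_map (subtopology ?T D) (subtopology ?U0 (gdom G ` W)) (grng G)"
    using cr by (intro continuous_map_into_subtopology[of _ ?U0] continuous_map_from_subtopology)
      (auto simp: D_def)
  have cs: "continuous_map (subtopology ?T D) ?T (\<lambda>k. \<tau> (grng G k))"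
    using continuous_map_compose[OF crD \<tau>c] continuous_map_into_fulltopology
    by (auto simp: o_def)
  have comp: "(\<tau> (grng G k), k) \<in> composable G" if "k \<in> D" for k
    using \<tau>W[OF that] that Wa by (auto simp: composable_def D_def)
  have "continuous_map (subtopology ?T D) (subtopology (prod_topology ?T ?T) (composable G))
     (\<lambda>k. (\<tau> (grng G k), k))"
    using cs comp
    by (intro continuous_map_into_subtopology)
      (auto simp: continuous_map_pairwise o_def intro: continuous_map_from_subtopology)
  from continuous_map_compose[OF this continuous_mult]
  have c\<phi>: "continuous_map (subtopology ?T D) ?T (\<lambda>k. gmult G (\<tau> (grng G k)) k)"
    by (simp add: o_def)
  have cis: "continuous_map (subtopology ?T D) ?T (\<lambda>k. ginv G (\<tau> (grng G k)))"
    using continuous_map_compose[OF cs continuous_inv] by (simp add: o_def)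
  define E where "E = {k \<in> D. gmult G (\<tau> (grng G k)) k \<in> V} \<inter> {k \<in> D. ginv G (\<tau> (grng G k)) \<in> U}"
  have DT: "D \<subseteq> arrows G" by (auto simp: D_def)
  have ED: "openin (subtopology ?T D) E"
    unfolding E_def
    using openin_continuous_map_preimage[OF c\<phi> V] openin_continuous_map_preimage[OF cis U] DT
    by (intro openin_Int) (simp_all add: Int_absorb1)
  have E: "openin ?T E" using ED D openin_trans_full by blast
  have r0: "grng G k0 = grng G g0" using gh rng_mult by simp
  have r0': "grng G k0 = gdom G (ginv G g0)" using r0 a dom_inv by simp
  have \<tau>0: "\<tau> (grng G k0) = ginv G g0" using r0' \<tau>d W by simp
  have "k0 \<in> D" using r0' W gh mult_closed by (auto simp: D_def)
  then have k0E: "k0 \<in> E"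
    unfolding E_def using \<tau>0 gh cancel inv_inv a by auto
  have "E \<subseteq> mult_sets G U V"
  proof
    fix k assume k: "k \<in> E"
    then have kD: "k \<in> D" by (auto simp: E_def)
    let ?t = "\<tau> (grng G k)"
    let ?h = "gmult G ?t k"
    have c: "(?t, k) \<in> composable G" using comp kD .
    have t: "?t \<in> arrows G" using c by (auto simp: composable_def)
    have "(ginv G ?t, ?h) \<in> composable G"
      using t c inv_closed mult_closed dom_inv rng_mult by (auto simp: composable_def)
    moreover have "gmult G (ginv G ?t) ?h = k" using cancel[OF c] .
    moreover have "ginv G ?t \<in> U" "?h \<in> V" using k by (auto simp: E_def)
    ultimately show "k \<in> mult_sets G U V" unfolding mult_sets_def by force
  qed
  then show "\<exists>T. openin ?T T \<and> k0 \<in> T \<and> T \<subseteq> mult_sets G U V"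
    using E k0E by blast
qed

lemma (in etale_groupoid)
  shows involutive_quantale_Omega: "involutive_quantale (Omega G)"
    and Sup_Omega: "S \<subseteq> carrier (Omega G) \<Longrightarrow> \<Squnion>\<^bsub>Omega G\<^esub>S = \<Union>S"
proof -
  have mo: "qmult (Omega G) = mult_sets G" and io: "qinv (Omega G) U = ginv G ` U" for U
    by (simp_all add: Omega_def)
  have sub: "U \<subseteq> arrows G" if "U \<in> carrier (Omega G)" for U
    using that openin_subset by (auto simp: Omega_def)
  have ms: "k \<in> mult_sets G U V \<longleftrightarrow> (\<exists>g\<in>U. \<exists>h\<in>V. (g, h) \<in> composable G \<and> k = gmult G g h)" for k U V
    by (auto simp: mult_sets_def)
  have ic: "qinv (Omega G) (qmult (Omega G) U V) = qmult (Omega G) (qinv (Omega G) V) (qinv (Omega G) U)"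
    if "U \<in> carrier (Omega G)" "V \<in> carrier (Omega G)" for U V
    unfolding mo io
  proof (intro equalityI subsetI)
    fix k assume "k \<in> ginv G ` mult_sets G U V"
    then obtain g h where *: "g \<in> U" "h \<in> V" "(g, h) \<in> composable G" "k = ginv G (gmult G g h)"
      using ms by auto
    then show "k \<in> mult_sets G (ginv G ` V) (ginv G ` U)"
      unfolding ms using inv_mult[OF *(3)] composable_inv[OF *(3)] by auto
  next
    fix k assume "k \<in> mult_sets G (ginv G ` V) (ginv G ` U)"
    then obtain g h where *: "g \<in> U" "h \<in> V" "(ginv G h, ginv G g) \<in> composable G"
        "k = gmult G (ginv G h) (ginv G g)"
      unfolding ms by auto
    have "(g, h) \<in> composable G"
      using composable_inv[OF *(3)] inv_inv[of g] inv_inv[of h] * sub that by (simp add: subset_iff)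
    then have "gmult G g h \<in> mult_sets G U V" "k = ginv G (gmult G g h)"
      using ms inv_mult * by auto
    then show "k \<in> ginv G ` mult_sets G U V" by blast
  qed
  have assoc: "qmult (Omega G) (qmult (Omega G) U V) W = qmult (Omega G) U (qmult (Omega G) V W)"
    if "U \<in> carrier (Omega G)" "V \<in> carrier (Omega G)" "W \<in> carrier (Omega G)" for U V W
    unfolding mo
  proof (intro equalityI subsetI)
    fix x assume "x \<in> mult_sets G (mult_sets G U V) W"
    then obtain g h k where *: "k \<in> W" "(gmult G g h, k) \<in> composable G" "g \<in> U" "h \<in> V"
        "(g, h) \<in> composable G" "x = gmult G (gmult G g h) k"
      by (auto simp: ms)
    have hk: "(h, k) \<in> composable G" using * dom_mult by (auto simp: composable_def)
    have "(g, gmult G h k) \<in> composable G"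
      using * mult_closed[OF hk] rng_mult[OF hk] by (auto simp: composable_def)
    moreover have "gmult G h k \<in> mult_sets G V W" using ms[of _ V W] * hk by blast
    moreover have "x = gmult G g (gmult G h k)" using mult_assoc[OF *(5) hk] * by simp
    ultimately show "x \<in> mult_sets G U (mult_sets G V W)" using *(3) ms[of x U] by blast
  next
    fix x assume "x \<in> mult_sets G U (mult_sets G V W)"
    then obtain g h k where *: "g \<in> U" "(g, gmult G h k) \<in> composable G" "h \<in> V" "k \<in> W"
        "(h, k) \<in> composable G" "x = gmult G g (gmult G h k)"
      by (auto simp: ms)
    have gh: "(g, h) \<in> composable G" using * rng_mult by (auto simp: composable_def)
    have "(gmult G g h, k) \<in> composable G"
      using * mult_closed[OF gh] dom_mult[OF gh] by (auto simp: composable_def)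
    moreover have "gmult G g h \<in> mult_sets G U V" using ms[of _ U V] * gh by blast
    moreover have "x = gmult G (gmult G g h) k" using mult_assoc[OF gh *(5)] * by simp
    ultimately show "x \<in> mult_sets G (mult_sets G U V) W" using *(4) ms[of x _ W] by blast
  qed
  have ii: "qinv (Omega G) (qinv (Omega G) U) = U" if "U \<in> carrier (Omega G)" for U
    using sub[OF that] inv_inv by (force simp: io image_image)
  have l: "qmult (Omega G) a (\<Union>S) = \<Union>(qmult (Omega G) a ` S)"
    and r: "qmult (Omega G) (\<Union>S) a = \<Union>((\<lambda>b. qmult (Omega G) b a) ` S)" for a S
    by (auto simp: mo mult_sets_def)
  have iS: "qinv (Omega G) (\<Union>S) = \<Union>(qinv (Omega G) ` S)" for S by (auto simp: io)
  have e: "eq (Omega G) = (=)" "le (Omega G) = (\<subseteq>)" by (simp_all add: Omega_def)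
  have c: "U \<in> carrier (Omega G) \<longleftrightarrow> openin (topo G) U" for U by (simp add: Omega_def)
  have J: "\<Union>S \<in> carrier (Omega G)" if "S \<subseteq> carrier (Omega G)" for S
    using that c by (auto intro: openin_Union)
  have least: "\<Union>S \<subseteq> x \<longleftrightarrow> (\<forall>y\<in>S. y \<subseteq> x)" for S and x :: "'a set" by auto
  have mc: "qmult (Omega G) U V \<in> carrier (Omega G)"
    if "U \<in> carrier (Omega G)" "V \<in> carrier (Omega G)" for U V
    using that openin_mult_sets unfolding c mo by auto
  have nc: "qinv (Omega G) U \<in> carrier (Omega G)" if "U \<in> carrier (Omega G)" for U
    using that openin_inv_image unfolding c io by auto
  note * = involutive_quantaleI[where Q = "Omega G" and J = Union,
    OF e J least mc nc assoc l r ii ic iS]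
  show "involutive_quantale (Omega G)" by (rule *(1))
  show "S \<subseteq> carrier (Omega G) \<Longrightarrow> \<Squnion>\<^bsub>Omega G\<^esub>S = \<Union>S" by (rule *(2))
qed

lemma star_scaleR: "star (r *\<^sub>R x) = r *\<^sub>R star (x :: 'a::cstar_algebra)"
  by (metis complex_cnj_complex_of_real scaleC_of_real star_scaleC)

lemma norm_star: "norm (star x) = norm (x :: 'a::cstar_algebra)"
proof -
  have le: "norm x \<le> norm (star x)" for x :: 'a
  proof (cases "norm x = 0")
    case False
    have "norm x * norm x \<le> norm (star x) * norm x"
      using cstar_identity[of x] norm_mult_ineq[of "star x" x] by (simp add: power2_eq_square)
    then show ?thesis using False by simp
  qed simp
  from le[of x] le[of "star x"] show ?thesis by (simp add: star_star)
qed

lemma bounded_linear_star: "bounded_linear (star :: 'a::cstar_algebra \<Rightarrow> 'a)"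
  by (rule bounded_linear_intro[where K = 1]) (simp_all add: star_add star_scaleR norm_star)

lemma bounded_linear_scaleC: "bounded_linear (scaleC c :: 'a::cstar_algebra \<Rightarrow> 'a)"
proof (rule bounded_linear_intro[where K = "cmod c"])
  fix r and x :: 'a
  show "scaleC c (r *\<^sub>R x) = r *\<^sub>R scaleC c x"
    by (metis mult.commute scaleC_of_real scaleC_scaleC)
qed (simp_all add: scaleC_add_right norm_scaleC)

lemma csubspace_closure:
  fixes S :: "'a::cstar_algebra set"
  assumes "csubspace S"
  shows "csubspace (closure S)"
proof (rule cspace.subspaceI)
  show "0 \<in> closure S" using cspace.subspace_0[OF assms] closure_subset by blast
next
  fix x y assume "x \<in> closure S" "y \<in> closure S"
  then obtain f g where "\<And>n. f n \<in> S" "f \<longlonglongrightarrow> x" "\<And>n. g n \<in> S" "g \<longlonglongrightarrow> y"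
    unfolding closure_sequential by metis
  then have "\<forall>n. f n + g n \<in> S" "(\<lambda>n. f n + g n) \<longlonglongrightarrow> x + y"
    using cspace.subspace_add[OF assms] tendsto_add by auto
  then show "x + y \<in> closure S"
    unfolding closure_sequential by (intro exI[of _ "\<lambda>n. f n + g n"] conjI)
next
  fix c x assume "x \<in> closure S"
  then obtain f where "\<And>n. f n \<in> S" "f \<longlonglongrightarrow> x" unfolding closure_sequential by metis
  then have "\<forall>n. scaleC c (f n) \<in> S" "(\<lambda>n. scaleC c (f n)) \<longlonglongrightarrow> scaleC c x"
    using cspace.subspace_scale[OF assms] bounded_linear.tendsto[OF bounded_linear_scaleC] by auto
  then show "scaleC c x \<in> closure S"
    unfolding closure_sequential by (intro exI[of _ "\<lambda>n. scaleC c (f n)"] conjI)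
qed

lemma csubspace_closed_cspan: "csubspace (closed_cspan S)"
  and closed_closed_cspan: "closed (closed_cspan S)"
  and subset_closed_cspan: "S \<subseteq> closed_cspan S"
  unfolding closed_cspan_def using cspace.subspace_span csubspace_closure closure_subset
    cspace.span_superset by (blast+)

lemma closed_cspan_minimal:
  "S \<subseteq> V \<Longrightarrow> csubspace V \<Longrightarrow> closed V \<Longrightarrow> closed_cspan S \<subseteq> V"
  unfolding closed_cspan_def by (intro closure_minimal cspace.span_minimal)

lemma closed_cspan_mult:
  fixes S T :: "'a::cstar_algebra set"
  shows "closed_cspan {a * b | a b. a \<in> closed_cspan S \<and> b \<in> closed_cspan T} =
    closed_cspan {a * b | a b. a \<in> S \<and> b \<in> T}" (is "?L = ?R")
proof
  have R: "csubspace ?R" "closed ?R" by (rule csubspace_closed_cspan closed_closed_cspan)+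
  have 1: "a * b \<in> ?R" if "a \<in> S" "b \<in> closed_cspan T" for a b
  proof -
    have "closed_cspan T \<subseteq> {b. a * b \<in> ?R}"
    proof (rule closed_cspan_minimal)
      have "a * b \<in> {a * b | a b. a \<in> S \<and> b \<in> T}" if "b \<in> T" for b
        using that \<open>a \<in> S\<close> by auto
      then show "T \<subseteq> {b. a * b \<in> ?R}"
        using subset_closed_cspan[of "{a * b | a b. a \<in> S \<and> b \<in> T}"] by blast
      show "csubspace {b. a * b \<in> ?R}"
        using R by (auto simp: cspace.subspace_def distrib_left scaleC_mult_right)
      show "closed {b. a * b \<in> ?R}"
        using closed_vimage[OF R(2) continuous_on_mult_left[OF continuous_on_id], of a]
        unfolding vimage_def .
    qed
    then show ?thesis using that by auto
  qed
  have 2: "a * b \<in> ?R" if "a \<in> closed_cspan S" "b \<in> closed_cspan T" for a b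
  proof -
    have "closed_cspan S \<subseteq> {a. a * b \<in> ?R}"
    proof (rule closed_cspan_minimal)
      show "S \<subseteq> {a. a * b \<in> ?R}" using 1[OF _ that(2)] by auto
      show "csubspace {a. a * b \<in> ?R}"
        using R by (auto simp: cspace.subspace_def distrib_right scaleC_mult_left)
      show "closed {a. a * b \<in> ?R}"
        using closed_vimage[OF R(2) continuous_on_mult_right[OF continuous_on_id], of b]
        unfolding vimage_def .
    qed
    then show ?thesis using that by auto
  qed
  show "?L \<subseteq> ?R"
  proof (rule closed_cspan_minimal)
    show "{a * b | a b. a \<in> closed_cspan S \<and> b \<in> closed_cspan T} \<subseteq> ?R" using 2 by auto
  qed (rule R)+
  show "?R \<subseteq> ?L"
  proof (rule closed_cspan_minimal)
    have "{a * b |a b. a \<in> S \<and> b \<in> T} \<subseteq> {a * b | a b. a \<in> closed_cspan S \<and> b \<in> closed_cspan T}"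
      using subset_closed_cspan[of S] subset_closed_cspan[of T] by auto
    also have "\<dots> \<subseteq> ?L" by (rule subset_closed_cspan)
    finally show "{a * b |a b. a \<in> S \<and> b \<in> T} \<subseteq> ?L" .
  qed (rule csubspace_closed_cspan closed_closed_cspan)+
qed

lemma closed_cspan_id: "csubspace V \<Longrightarrow> closed V \<Longrightarrow> closed_cspan V = V"
  using closed_cspan_minimal[of V V] subset_closed_cspan[of V] by auto

lemma star_image: "star ` V = star -` (V :: 'a::cstar_algebra set)"
proof
  show "star -` V \<subseteq> star ` V"
  proof
    fix x assume "x \<in> star -` V"
    then show "x \<in> star ` V" using star_star[of x] by (metis imageI vimageE)
  qed
qed (auto simp: star_star)

lemma csubspace_star:
  fixes V :: "'a::cstar_algebra set"
  assumes V: "csubspace V"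
  shows "csubspace (star ` V)"
proof -
  have z: "star (0::'a) = 0" using star_scaleC[of 0 "0::'a"] by simp
  show ?thesis unfolding star_image
    using V by (auto simp: cspace.subspace_def star_add star_scaleC z)
qed

lemma closed_star:
  fixes V :: "'a::cstar_algebra set"
  assumes "closed V" shows "closed (star ` V)"
proof -
  show ?thesis
    unfolding star_image
    using assms linear_continuous_on[OF bounded_linear_star] by (rule closed_vimage)
qed

lemma star_closed_cspan:
  fixes S :: "'a::cstar_algebra set"
  shows "star ` closed_cspan S = closed_cspan (star ` S)"
proof -
  have le: "closed_cspan (star ` S) \<subseteq> star ` closed_cspan S" for S :: "'a set"
    using subset_closed_cspan[of S]
    by (intro closed_cspan_minimal csubspace_star closed_star csubspace_closed_cspan closed_closed_cspan) auto
  have "star ` closed_cspan S = star ` closed_cspan (star ` star ` S)"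
    by (simp add: image_image star_star)
  also have "\<dots> \<subseteq> star ` star ` closed_cspan (star ` S)" using le[of "star ` S"] by blast
  finally show ?thesis using le[of S] by (simp add: image_image star_star)
qed

lemma
  shows involutive_quantale_Max: "involutive_quantale (Max_quantale :: 'a::cstar_algebra set quantale_struct)"
    and Sup_Max: "S \<subseteq> carrier (Max_quantale :: 'a set quantale_struct) \<Longrightarrow>
      \<Squnion>\<^bsub>Max_quantale\<^esub>S = closed_cspan (\<Union>S)"
proof -
  let ?Q = "Max_quantale :: 'a set quantale_struct"
  let ?J = "\<lambda>S :: 'a set set. closed_cspan (\<Union>S)"
  have cQ: "V \<in> carrier ?Q \<longleftrightarrow> csubspace V \<and> closed V" for V by (simp add: Max_quantale_def)
  have mQ: "qmult ?Q V W = closed_cspan {a * b | a b. a \<in> V \<and> b \<in> W}" for V W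
    by (simp add: Max_quantale_def)
  have iQ: "qinv ?Q V = star ` V" for V by (simp add: Max_quantale_def)
  have cc: "closed_cspan S \<in> carrier ?Q" for S
    by (simp add: cQ csubspace_closed_cspan closed_closed_cspan)
  have id: "closed_cspan V = V" if "V \<in> carrier ?Q" for V using that cQ closed_cspan_id by blast
  have mm: "qmult ?Q (closed_cspan S) (closed_cspan T) = closed_cspan {a * b | a b. a \<in> S \<and> b \<in> T}" for S T
    unfolding mQ by (rule closed_cspan_mult)
  have JJ: "?J (closed_cspan ` F) = closed_cspan (\<Union>F)" for F :: "'a set set"
  proof
    show "?J (closed_cspan ` F) \<subseteq> closed_cspan (\<Union>F)"
      using subset_closed_cspan[of "\<Union>F"]
      by (intro closed_cspan_minimal csubspace_closed_cspan closed_closed_cspan UN_least) blast+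
    show "closed_cspan (\<Union>F) \<subseteq> ?J (closed_cspan ` F)"
    proof (rule closed_cspan_minimal)
      show "\<Union>F \<subseteq> ?J (closed_cspan ` F)"
        using subset_closed_cspan[of "\<Union>(closed_cspan ` F)"] subset_closed_cspan by blast
    qed (rule csubspace_closed_cspan closed_closed_cspan)+
  qed
  have assoc: "qmult ?Q (qmult ?Q a b) c = qmult ?Q a (qmult ?Q b c)"
    if "a \<in> carrier ?Q" "b \<in> carrier ?Q" "c \<in> carrier ?Q" for a b c
  proof -
    have "qmult ?Q (qmult ?Q a b) c = qmult ?Q (closed_cspan {x * y | x y. x \<in> a \<and> y \<in> b}) (closed_cspan c)"
      using that by (simp add: id) (simp add: mQ)
    also have "\<dots> = closed_cspan {u * z | u z. u \<in> {x * y | x y. x \<in> a \<and> y \<in> b} \<and> z \<in> c}" by (rule mm)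
    also have "{u * z | u z. u \<in> {x * y | x y. x \<in> a \<and> y \<in> b} \<and> z \<in> c} =
       {x * u | x u. x \<in> a \<and> u \<in> {y * z | y z. y \<in> b \<and> z \<in> c}}"
      by (auto simp: mult.assoc) (metis mult.assoc)+
    also have "closed_cspan \<dots> = qmult ?Q (closed_cspan a) (closed_cspan {y * z | y z. y \<in> b \<and> z \<in> c})"
      by (rule mm[symmetric])
    also have "\<dots> = qmult ?Q a (qmult ?Q b c)" using that by (simp add: id) (simp add: mQ)
    finally show ?thesis .
  qed
  have d1: "qmult ?Q a (?J S) = ?J (qmult ?Q a ` S)" if "a \<in> carrier ?Q" for a S
  proof -
    have "qmult ?Q a (?J S) = qmult ?Q (closed_cspan a) (?J S)" using that by (simp add: id)
    also have "\<dots> = closed_cspan {x * y | x y. x \<in> a \<and> y \<in> \<Union>S}" by (rule mm)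
    also have "{x * y | x y. x \<in> a \<and> y \<in> \<Union>S} = \<Union>((\<lambda>b. {x * y | x y. x \<in> a \<and> y \<in> b}) ` S)"
      by auto
    also note JJ[symmetric]
    finally show ?thesis by (simp add: Max_quantale_def image_image)
  qed
  have d2: "qmult ?Q (?J S) a = ?J ((\<lambda>b. qmult ?Q b a) ` S)" if "a \<in> carrier ?Q" for a S
  proof -
    have "qmult ?Q (?J S) a = qmult ?Q (?J S) (closed_cspan a)" using that by (simp add: id)
    also have "\<dots> = closed_cspan {x * y | x y. x \<in> \<Union>S \<and> y \<in> a}" by (rule mm)
    also have "{x * y | x y. x \<in> \<Union>S \<and> y \<in> a} = \<Union>((\<lambda>b. {x * y | x y. x \<in> b \<and> y \<in> a}) ` S)"
      by auto
    also note JJ[symmetric]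
    finally show ?thesis by (simp add: Max_quantale_def image_image)
  qed
  have im: "qinv ?Q (qmult ?Q a b) = qmult ?Q (qinv ?Q b) (qinv ?Q a)" for a b
  proof -
    have "star ` {x * y | x y. x \<in> a \<and> y \<in> b} = {x * y | x y. x \<in> star ` b \<and> y \<in> star ` a}"
      by (force simp: star_mult)
    then show ?thesis by (simp add: iQ mQ star_closed_cspan)
  qed
  have iS: "qinv ?Q (?J S) = ?J (qinv ?Q ` S)" for S
    by (simp add: iQ star_closed_cspan image_Union image_image)
  have least: "?J S \<subseteq> x \<longleftrightarrow> (\<forall>y\<in>S. y \<subseteq> x)" if "x \<in> carrier ?Q" for S x
    using that cQ closed_cspan_minimal[of "\<Union>S" x] subset_closed_cspan[of "\<Union>S"] by blast
  have ic: "qinv ?Q a \<in> carrier ?Q" if "a \<in> carrier ?Q" for a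
    using that by (simp add: iQ cQ csubspace_star closed_star)
  have mc: "qmult ?Q a b \<in> carrier ?Q" for a b unfolding mQ by (rule cc)
  have ii: "qinv ?Q (qinv ?Q a) = a" for a by (simp add: iQ image_image star_star)
  have e: "eq ?Q = (=)" "le ?Q = (\<subseteq>)" by (simp_all add: Max_quantale_def)
  note * = involutive_quantaleI[where Q = ?Q and J = ?J, OF e cc least mc ic assoc d1 d2 ii im iS]
  show "involutive_quantale ?Q" by (rule *(1))
  show "S \<subseteq> carrier ?Q \<Longrightarrow> \<Squnion>\<^bsub>?Q\<^esub>S = closed_cspan (\<Union>S)" by (rule *(2))
qed

text \<open>The left adjoint is unique on the carrier, so quantifying over all left adjoints
  amounts to speaking about \<open>p\<^sub>!\<close>.\<close>

definition stable_quantic_bundle ::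
    "'q quantale_struct \<Rightarrow> 'g groupoid \<Rightarrow> ('g set \<Rightarrow> 'q) \<Rightarrow> bool" where
  "stable_quantic_bundle Q G ps \<longleftrightarrow>
     quantale_map Q (Omega G) ps \<and> semiopen_map Q (Omega G) ps \<and> surjection_map (Omega G) ps \<and>
     (\<forall>pl. left_adjoint Q (Omega G) ps pl \<longrightarrow>
        (\<forall>U \<in> carrier (Omega G). \<forall>a \<in> carrier Q. \<forall>b \<in> carrier Q.
           pl (qmult Q (qmult Q a (ps U)) b) =
           qmult (Omega G) (qmult (Omega G) (pl a) U) (pl b)))"


section \<open>The convolution algebra\<close>

text \<open>Functions on the groupoid are represented by functions on the whole type that vanish
  outside the set of arrows. \<open>Cc G U\<close> is meant for Hausdorff open \<open>U\<close>; it is only used for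
  local bisections, which are Hausdorff because they embed into the unit space.\<close>

definition Cc :: "'g groupoid \<Rightarrow> 'g set \<Rightarrow> ('g \<Rightarrow> complex) set" where
  "Cc G U = {s. (\<forall>g. g \<notin> U \<longrightarrow> s g = 0) \<and> continuous_map (subtopology (topo G) U) euclidean s \<and>
     (\<exists>K. compactin (topo G) K \<and> {g. s g \<noteq> 0} \<subseteq> K \<and> K \<subseteq> U)}"

definition fscale :: "complex \<Rightarrow> ('g \<Rightarrow> complex) \<Rightarrow> 'g \<Rightarrow> complex" where
  "fscale c s = (\<lambda>g. c * s g)"

global_interpretation fspace: vector_space "fscale :: complex \<Rightarrow> ('g \<Rightarrow> complex) \<Rightarrow> 'g \<Rightarrow> complex"
  defines fspan = fspace.span
  by unfold_locales (auto simp: fscale_def plus_fun_def algebra_simps)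

definition conv_algebra :: "'g groupoid \<Rightarrow> ('g \<Rightarrow> complex) set" where
  "conv_algebra G = fspan (\<Union>{Cc G U | U. local_bisection G U})"

text \<open>On the convolution algebra the sum is finite: a function supported in a local bisection is
  nonzero at no more than one arrow with a given range, and \<open>k\<close> is determined by \<open>g\<close> and \<open>h\<close>.\<close>

definition conv :: "'g groupoid \<Rightarrow> ('g \<Rightarrow> complex) \<Rightarrow> ('g \<Rightarrow> complex) \<Rightarrow> 'g \<Rightarrow> complex" where
  "conv G s t g = (\<Sum>(h, k) \<in> {(h, k) \<in> composable G. gmult G h k = g \<and> s h \<noteq> 0 \<and> t k \<noteq> 0}. s h * t k)"

definition fstar :: "'g groupoid \<Rightarrow> ('g \<Rightarrow> complex) \<Rightarrow> 'g \<Rightarrow> complex" where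
  "fstar G s g = (if g \<in> arrows G then cnj (s (ginv G g)) else 0)"

text \<open>The supremum may be taken over the whole type since \<open>s\<close> vanishes outside the arrows.\<close>

definition sup_norm :: "('g \<Rightarrow> complex) \<Rightarrow> real" where
  "sup_norm s = (SUP g. cmod (s g))"

definition cstar_norm :: "'g groupoid \<Rightarrow> (('g \<Rightarrow> complex) \<Rightarrow> real) \<Rightarrow> bool" where
  "cstar_norm G N \<longleftrightarrow>
     (\<forall>s \<in> conv_algebra G. 0 \<le> N s \<and> (N s = 0 \<longleftrightarrow> s = 0) \<and>
        (\<forall>c. N (fscale c s) = cmod c * N s) \<and> N (conv G (fstar G s) s) = (N s)\<^sup>2) \<and>
     (\<forall>s \<in> conv_algebra G. \<forall>t \<in> conv_algebra G.
        N (s + t) \<le> N s + N t \<and> N (conv G s t) \<le> N s * N t)"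

definition compatible_norm :: "'g groupoid \<Rightarrow> (('g \<Rightarrow> complex) \<Rightarrow> real) \<Rightarrow> bool" where
  "compatible_norm G N \<longleftrightarrow> cstar_norm G N \<and>
     (\<forall>s \<in> conv_algebra G. sup_norm s \<le> N s) \<and>
     (\<forall>U. local_bisection G U \<longrightarrow> (\<forall>s \<in> Cc G U. sup_norm s = N s))"

text \<open>The completion of the convolution algebra in \<open>N\<close>: a C*-algebra together with an isometric
  *-homomorphism of dense image. The values of \<open>\<iota>\<close> outside the convolution algebra are irrelevant.\<close>

definition cstar_completion ::
    "'g groupoid \<Rightarrow> (('g \<Rightarrow> complex) \<Rightarrow> real) \<Rightarrow> (('g \<Rightarrow> complex) \<Rightarrow> 'a::cstar_algebra) \<Rightarrow> bool" where
  "cstar_completion G N \<iota> \<longleftrightarrow>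
     (\<forall>s \<in> conv_algebra G. norm (\<iota> s) = N s \<and> \<iota> (fstar G s) = star (\<iota> s) \<and>
        (\<forall>c. \<iota> (fscale c s) = scaleC c (\<iota> s))) \<and>
     (\<forall>s \<in> conv_algebra G. \<forall>t \<in> conv_algebra G.
        \<iota> (s + t) = \<iota> s + \<iota> t \<and> \<iota> (conv G s t) = \<iota> s * \<iota> t) \<and>
     closure (\<iota> ` conv_algebra G) = UNIV"

definition compatible_completion ::
    "'g groupoid \<Rightarrow> (('g \<Rightarrow> complex) \<Rightarrow> real) \<Rightarrow> (('g \<Rightarrow> complex) \<Rightarrow> 'a::cstar_algebra) \<Rightarrow> bool" where
  "compatible_completion G N \<iota> \<longleftrightarrow> compatible_norm G N \<and> cstar_completion G N \<iota>"

definition eval_at :: "'g groupoid \<Rightarrow> (('g \<Rightarrow> complex) \<Rightarrow> 'a::cstar_algebra) \<Rightarrow> 'g \<Rightarrow> 'a \<Rightarrow> complex" where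
  "eval_at G \<iota> g = (THE f. Vector_Spaces.linear scaleC (*) f \<and> continuous_on UNIV f \<and>
     (\<forall>s \<in> conv_algebra G. f (\<iota> s) = s g))"

definition assoc_map :: "'g groupoid \<Rightarrow> (('g \<Rightarrow> complex) \<Rightarrow> 'a::cstar_algebra) \<Rightarrow> 'g set \<Rightarrow> 'a set" where
  "assoc_map G \<iota> V = closed_cspan (\<Union>{\<iota> ` Cc G U | U. local_bisection G U \<and> U \<subseteq> V})"

definition open_support :: "'g groupoid \<Rightarrow> (('g \<Rightarrow> complex) \<Rightarrow> 'a::cstar_algebra) \<Rightarrow> 'a \<Rightarrow> 'g set" where
  "open_support G \<iota> a = (topo G) interior_of {g \<in> arrows G. eval_at G \<iota> g a \<noteq> 0}"

definition gamma :: "'g groupoid \<Rightarrow> (('g \<Rightarrow> complex) \<Rightarrow> 'a::cstar_algebra) \<Rightarrow> 'g set \<Rightarrow> 'a set" where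
  "gamma G \<iota> V = closed_cspan {a. open_support G \<iota> a \<subseteq> V}"

definition localizable_completion ::
    "'g groupoid \<Rightarrow> (('g \<Rightarrow> complex) \<Rightarrow> real) \<Rightarrow> (('g \<Rightarrow> complex) \<Rightarrow> 'a::cstar_algebra) \<Rightarrow> bool" where
  "localizable_completion G N \<iota> \<longleftrightarrow> compatible_completion G N \<iota> \<and>
     (\<forall>V. openin (topo G) V \<longrightarrow> assoc_map G \<iota> V = gamma G \<iota> V)"

end

theory Submission
  imports Defs
begin

text \<open>
  Let \<open>g\<close> be an arrow with domain and range \<open>x\<close>, and suppose
  \<open>g \<noteq> x\<close>. Choose local bisections \<open>U\<close> around \<open>x\<close> and \<open>W\<close>
  around \<open>g\<close>, and real-valued functions \<open>f\<close> in \<open>C\<^sub>c(U)\<close> and \<open>s\<close> in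
  \<open>C\<^sub>c(W)\<close> with \<open>f(x) = s(g) = 1\<close>. The domain map is injective on \<open>U\<close> and on
  \<open>W\<close>, so \<open>f(g) = s(x) = 0\<close>. Put \<open>a = f + \<i> s\<close> and \<open>b = f - \<i> s\<close>.

  If \<open>\<phi>\<close> is supported in \<open>U\<close>, the only factorizations of \<open>g\<close> that can contribute to
  \<open>(a \<phi> b)(g)\<close> are \<open>x x g\<close> and \<open>g x x\<close>. Their contributions are
  \<open>- \<i> f(x) \<phi>(x) s(g)\<close> and \<open>\<i> s(g) \<phi>(x) f(x)\<close>, which cancel. By linearity and
  continuity \<open>eval\<^sub>g\<close> vanishes on the product \<open>\<langle>a\<rangle> p\<^sup>*(U) \<langle>b\<rangle>\<close> in \<open>Max A\<close>.
  Now \<open>p\<^sub>!\<close> of a closed subspace is the union of the open supports of its elements (this is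
  \<open>left_adjoint_eq_open_supports\<close>, and it rests on localizability), so \<open>g\<close> does not
  belong to \<open>p\<^sub>!(\<langle>a\<rangle> p\<^sup>*(U) \<langle>b\<rangle>)\<close>.

  On the other hand, because \<open>f\<close> and \<open>s\<close> are real, \<open>a\<close> and \<open>b\<close> do not vanish on the open
  sets \<open>{f \<noteq> 0}\<close> and \<open>{s \<noteq> 0}\<close>. Hence \<open>x\<close> is in \<open>p\<^sub>!(\<langle>a\<rangle>)\<close>,
  \<open>g\<close> is in \<open>p\<^sub>!(\<langle>b\<rangle>)\<close>, and \<open>g = x x g\<close> is in
  \<open>p\<^sub>!(\<langle>a\<rangle>) U p\<^sub>!(\<langle>b\<rangle>)\<close>. This contradicts stability
  (\<open>principal_if_stable\<close>). So the groupoid is principal, and a principal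
  groupoid with Hausdorff unit space is Hausdorff: two arrows with the same domain and range differ by
  isotropy, hence coincide (\<open>Hausdorff_if_principal\<close>).

  The computation of \<open>(a \<phi> b)(g)\<close> takes place in the completion, so it needs two facts about the
  convolution algebra: products of functions supported in local bisections are again of this kind, with
  the expected values (\<open>conv_in_Cc\<close>, \<open>conv_gmult\<close>), and evaluation at an arrow extends
  to the completion (\<open>eval_exists_unique\<close>).
\<close>

section \<open>Local bisections\<close>

text \<open>The domain and the range map of an etale groupoid are continuous and open. On a local bisection
  they are also injective, so that they identify it with an open set of units; this is how
  properties of the unit space reach local bisections, and how an arrow of a local bisection is
  recovered continuously from its domain or its range.\<close>
lemma homeomorphic_map_open_injective:
  assumes f: "continuous_map X Y f" "open_map X Y f" and U: "openin X U" "inj_on f U"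
  shows "homeomorphic_map (subtopology X U) (subtopology Y (f ` U)) f"
proof (rule bijective_open_imp_homeomorphic_map)
  have sub: "U \<subseteq> topspace X" using U openin_subset by blast
  have Y: "f ` U \<subseteq> topspace Y" using sub f(1) continuous_map_image_subset_topspace by blast
  show "continuous_map (subtopology X U) (subtopology Y (f ` U)) f"
    using f(1) by (intro continuous_map_into_subtopology continuous_map_from_subtopology) auto
  show "open_map (subtopology X U) (subtopology Y (f ` U)) f"
    using f(2) U(1) by (intro open_map_into_subtopology open_map_from_subtopology) auto
  show "f ` topspace (subtopology X U) = topspace (subtopology Y (f ` U))"
    using sub Y by (simp add: Int_absorb1)
  show "inj_on f (topspace (subtopology X U))"
    using U(2) sub by (simp add: Int_absorb1)
qed

lemma local_homeomorphism_imp_open_map: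
  assumes "local_homeomorphism X Y f"
  shows "open_map X Y f"
  unfolding open_map_def
proof safe
  fix V assume V: "openin X V"
  show "openin Y (f ` V)"
  proof (subst openin_subopen, safe)
    fix x assume x: "x \<in> V"
    then have "x \<in> topspace X" using V openin_subset by blast
    then obtain U where U: "openin X U" "x \<in> U" "openin Y (f ` U)"
        "homeomorphic_map (subtopology X U) (subtopology Y (f ` U)) f"
      using assms unfolding local_homeomorphism_def by blast
    have "openin (subtopology X U) (U \<inter> V)" using V by (rule openin_subtopology_Int2)
    then have "openin (subtopology Y (f ` U)) (f ` (U \<inter> V))"
      using homeomorphic_imp_open_map[OF U(4)] by (auto simp: open_map_def)
    then have "openin Y (f ` (U \<inter> V))" using U(3) openin_trans_full by blast
    then show "\<exists>T. openin Y T \<and> f x \<in> T \<and> T \<subseteq> f ` V"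
      using x U(2) by (intro exI[of _ "f ` (U \<inter> V)"]) auto
  qed
qed

context topological_groupoid
begin

lemma unit_props:
  assumes "x \<in> units G"
  shows "x \<in> arrows G" "gdom G x = x" "grng G x = x"
proof -
  obtain g where g: "g \<in> arrows G" "x = gdom G g" using assms by (auto simp: units_def)
  have c: "(ginv G g, g) \<in> composable G"
    using g inv_closed dom_inv by (auto simp: composable_def)
  have x: "x = gmult G (ginv G g) g" using g by (simp add: gdom_def)
  show "x \<in> arrows G" using mult_closed[OF c] x by simp
  show "gdom G x = x" using dom_mult[OF c] x g by simp
  show "grng G x = x" using rng_mult[OF c] x g rng_inv by simp
qed

lemma gdom_in_units: "g \<in> arrows G \<Longrightarrow> gdom G g \<in> units G"
  by (auto simp: units_def)

lemma grng_in_units: "g \<in> arrows G \<Longrightarrow> grng G g \<in> units G"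
  using gdom_in_units[OF inv_closed] dom_inv by simp

lemma continuous_gdom: "continuous_map (topo G) (subtopology (topo G) (units G)) (gdom G)"
proof (rule continuous_map_into_subtopology)
  let ?T = "topo G"
  have "continuous_map ?T (subtopology (prod_topology ?T ?T) (composable G)) (\<lambda>g. (ginv G g, g))"
    using continuous_inv
    by (intro continuous_map_into_subtopology)
      (auto simp: continuous_map_pairwise o_def composable_def dom_inv inv_closed)
  from continuous_map_compose[OF this continuous_mult] show "continuous_map ?T ?T (gdom G)"
    by (simp add: o_def gdom_def[abs_def])
qed (auto simp: units_def)

lemma continuous_grng: "continuous_map (topo G) (subtopology (topo G) (units G)) (grng G)"
  using continuous_map_compose[OF continuous_inv continuous_gdom]
  by (rule continuous_map_eq) (auto simp: dom_inv)

lemma open_map_ginv: "open_map (topo G) (topo G) (ginv G)"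
  using openin_inv_image by (simp add: open_map_def)

lemma inj_on_grng_inv_image:
  assumes "U \<subseteq> arrows G" "inj_on (gdom G) U"
  shows "inj_on (grng G) (ginv G ` U)"
proof (intro inj_onI, clarify)
  fix g h assume "g \<in> U" "h \<in> U" "grng G (ginv G g) = grng G (ginv G h)"
  then have "gdom G g = gdom G h" using assms(1) rng_inv by (simp add: subset_iff)
  then show "ginv G g = ginv G h" using assms(2) \<open>g \<in> U\<close> \<open>h \<in> U\<close> by (auto dest: inj_onD)
qed

end

context etale_groupoid
begin

lemma open_map_gdom: "open_map (topo G) (subtopology (topo G) (units G)) (gdom G)"
  by (rule local_homeomorphism_imp_open_map[OF etale])

lemma open_map_grng: "open_map (topo G) (subtopology (topo G) (units G)) (grng G)"
  using open_map_compose[OF open_map_ginv open_map_gdom]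
  by (rule open_map_eq) (simp add: dom_inv)

text \<open>The local homeomorphism condition makes the domain map injective near every arrow. Inversion
  exchanges domain and range, so the same holds for the range map.\<close>
lemma local_bisection_exists:
  assumes g: "g \<in> arrows G"
  shows "\<exists>U. local_bisection G U \<and> g \<in> U"
proof -
  have dom: "\<exists>U. openin (topo G) U \<and> h \<in> U \<and> inj_on (gdom G) U" if h: "h \<in> arrows G" for h
  proof -
    obtain U where U: "openin (topo G) U" "h \<in> U"
      "homeomorphic_map (subtopology (topo G) U)
         (subtopology (subtopology (topo G) (units G)) (gdom G ` U)) (gdom G)"
      using etale h unfolding local_homeomorphism_def by blast
    have "inj_on (gdom G) U"
      using homeomorphic_imp_injective_map[OF U(3)] openin_subset[OF U(1)] by (simp add: Int_absorb1)
    then show ?thesis using U by blast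
  qed
  obtain U where U: "openin (topo G) U" "g \<in> U" "inj_on (gdom G) U" using dom[OF g] by blast
  obtain V where V: "openin (topo G) V" "ginv G g \<in> V" "inj_on (gdom G) V"
    using dom[OF inv_closed[OF g]] by blast
  have "inj_on (grng G) (ginv G ` V)"
    using V openin_subset by (intro inj_on_grng_inv_image) auto
  moreover have "g \<in> ginv G ` V" using V(2) inv_inv[OF g] by (metis imageI)
  ultimately have "local_bisection G (U \<inter> ginv G ` V)" "g \<in> U \<inter> ginv G ` V"
    using U V openin_inv_image by (auto simp: local_bisection_def inj_on_Int)
  then show ?thesis by blast
qed

lemma local_bisection_homeomorphic:
  assumes "local_bisection G U"
  shows "homeomorphic_map (subtopology (topo G) U)
     (subtopology (subtopology (topo G) (units G)) (gdom G ` U)) (gdom G)"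
  using assms unfolding local_bisection_def
  by (intro homeomorphic_map_open_injective[OF continuous_gdom open_map_gdom]) blast+

lemma local_bisection_topology:
  assumes U: "local_bisection G U"
  shows "Hausdorff_space (subtopology (topo G) U)"
    and "locally_compact_space (subtopology (topo G) U)"
proof -
  let ?U0 = "subtopology (topo G) (units G)"
  have hom: "subtopology (topo G) U homeomorphic_space subtopology ?U0 (gdom G ` U)"
    using local_bisection_homeomorphic[OF U] homeomorphic_map_imp_homeomorphic_space by blast
  have "openin ?U0 (gdom G ` U)"
    using U open_map_gdom by (auto simp: local_bisection_def open_map_def)
  then show "locally_compact_space (subtopology (topo G) U)"
    unfolding homeomorphic_locally_compact_space[OF hom]
    using locally_compact_space_open_subset Hausdorff_units locally_compact_units by blast
  show "Hausdorff_space (subtopology (topo G) U)"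
    unfolding homeomorphic_Hausdorff_space[OF hom]
    using Hausdorff_units Hausdorff_space_subtopology by blast
qed

lemma local_bisection_mult_sets:
  assumes U: "local_bisection G U" and V: "local_bisection G V"
  shows "local_bisection G (mult_sets G U V)"
  unfolding local_bisection_def
proof (intro conjI)
  show "openin (topo G) (mult_sets G U V)"
    using U V openin_mult_sets by (auto simp: local_bisection_def)
  show "inj_on (gdom G) (mult_sets G U V)"
  proof (rule inj_onI)
    fix a b assume "a \<in> mult_sets G U V" "b \<in> mult_sets G U V" and e: "gdom G a = gdom G b"
    then obtain h k h' k' where a: "a = gmult G h k" "h \<in> U" "k \<in> V" "(h, k) \<in> composable G"
      and b: "b = gmult G h' k'" "h' \<in> U" "k' \<in> V" "(h', k') \<in> composable G"
      by (auto simp: mult_sets_def)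
    have "k = k'" using e a b dom_mult V by (auto simp: local_bisection_def dest: inj_onD)
    moreover from this have "gdom G h = gdom G h'" using a b by (auto simp: composable_def)
    then have "h = h'" using a b U by (auto simp: local_bisection_def dest: inj_onD)
    ultimately show "a = b" using a b by simp
  qed
  show "inj_on (grng G) (mult_sets G U V)"
  proof (rule inj_onI)
    fix a b assume "a \<in> mult_sets G U V" "b \<in> mult_sets G U V" and e: "grng G a = grng G b"
    then obtain h k h' k' where a: "a = gmult G h k" "h \<in> U" "k \<in> V" "(h, k) \<in> composable G"
      and b: "b = gmult G h' k'" "h' \<in> U" "k' \<in> V" "(h', k') \<in> composable G"
      by (auto simp: mult_sets_def)
    have "h = h'" using e a b rng_mult U by (auto simp: local_bisection_def dest: inj_onD)
    moreover from this have "grng G k = grng G k'"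
      using a b by (auto simp: composable_def)
    then have "k = k'" using a b V by (auto simp: local_bisection_def dest: inj_onD)
    ultimately show "a = b" using a b by simp
  qed
qed

text \<open>Composable pairs are the equalizer of two continuous maps into the unit space, which is Hausdorff
  even when the groupoid is not. This is what keeps products of compact sets compact.\<close>
lemma closedin_composable: "closedin (prod_topology (topo G) (topo G)) (composable G)"
proof -
  let ?P = "prod_topology (topo G) (topo G)"
  have "continuous_map ?P (subtopology (topo G) (units G)) (\<lambda>p. gdom G (fst p))"
       "continuous_map ?P (subtopology (topo G) (units G)) (\<lambda>p. grng G (snd p))"
    using continuous_map_compose[OF continuous_map_fst continuous_gdom, of "topo G"]
      continuous_map_compose[OF continuous_map_snd continuous_grng, of "topo G"]
    by (simp_all add: o_def)
  from closedin_continuous_maps_eq[OF Hausdorff_units this]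
  have "closedin ?P {p \<in> topspace ?P. gdom G (fst p) = grng G (snd p)}" .
  also have "{p \<in> topspace ?P. gdom G (fst p) = grng G (snd p)} = composable G"
    by (auto simp: composable_def)
  finally show ?thesis .
qed

lemma compactin_mult_sets:
  assumes "compactin (topo G) K" "compactin (topo G) L"
  shows "compactin (topo G) (mult_sets G K L)"
proof -
  let ?P = "prod_topology (topo G) (topo G)"
  have "compactin ?P (composable G \<inter> K \<times> L)"
    using assms closedin_composable by (intro closed_Int_compactin) (auto simp: compactin_Times)
  then have "compactin (subtopology ?P (composable G)) (composable G \<inter> K \<times> L)"
    by (simp add: compactin_subtopology)
  from image_compactin[OF this continuous_mult]
  have "compactin (topo G) ((\<lambda>(g, h). gmult G g h) ` (composable G \<inter> K \<times> L))" .
  also have "(\<lambda>(g, h). gmult G g h) ` (composable G \<inter> K \<times> L) = mult_sets G K L"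
    by (force simp: mult_sets_def)
  finally show ?thesis .
qed

text \<open>Urysohn's lemma on a local bisection. The values are real because two real functions \<open>f\<close> and
  \<open>s\<close> cannot cancel each other in \<open>f \<plusminus> \<i> s\<close>.\<close>
lemma local_bisection_function_exists:
  assumes U: "local_bisection G U" and g: "g \<in> U"
  shows "\<exists>s \<in> Cc G U. s g = 1 \<and> (\<forall>h. s h \<in> \<real>)"
proof -
  let ?X = "subtopology (topo G) U"
  have top: "topspace ?X = U"
    using U openin_subset by (auto simp: local_bisection_def)
  have X: "Hausdorff_space ?X" "locally_compact_space ?X" by (rule local_bisection_topology[OF U])+
  obtain S K where S: "openin ?X S" "compactin ?X K" "g \<in> S" "S \<subseteq> K"
    using X(2)[unfolded locally_compact_space_def, rule_format, of g] g top by auto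
  have "completely_regular_space ?X"
    using X locally_compact_regular_imp_completely_regular_space by blast
  then obtain f where f: "continuous_map ?X euclideanreal f" "f g = 0" "f ` (topspace ?X - S) \<subseteq> {1}"
    using S(1,3) unfolding completely_regular_space_alt' by meson
  define s where "s h = (if h \<in> U then complex_of_real (1 - f h) else 0)" for h
  have "continuous_map ?X euclidean (complex_of_real \<circ> (\<lambda>h. 1 - f h))"
    using f(1) by (intro continuous_map_compose[where X' = euclideanreal])
      (auto intro!: continuous_map_diff continuous_intros)
  then have "continuous_map ?X euclidean s"
    by (rule continuous_map_eq) (simp add: s_def)
  moreover have "s h = 0" if "h \<notin> S" for h using f(3) top that by (auto simp: s_def)
  then have "{h. s h \<noteq> 0} \<subseteq> K" using S(4) by blast
  moreover have "\<forall>h. h \<notin> U \<longrightarrow> s h = 0" by (simp add: s_def)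
  ultimately have "s \<in> Cc G U"
    using S(2) unfolding Cc_def compactin_subtopology by blast
  moreover have "s g = 1" "\<forall>h. s h \<in> \<real>" using f(2) g by (simp_all add: s_def)
  ultimately show ?thesis by blast
qed

end

section \<open>Convolution\<close>

context topological_groupoid
begin

text \<open>In a set on which the range map is injective, \<open>h\<close> is the only possible first factor
  of \<open>gmult G h k\<close>, and \<open>k\<close> is then determined by cancellation. So the
  convolution sum has one term, whatever \<open>t\<close> is.\<close>
lemma conv_gmult:
  assumes U: "inj_on (grng G) U" and s: "\<And>h. h \<notin> U \<Longrightarrow> s h = 0"
    and c: "(h, k) \<in> composable G" and h: "h \<in> U"
  shows "conv G s t (gmult G h k) = s h * t k"
proof -
  let ?I = "{(h', k') \<in> composable G. gmult G h' k' = gmult G h k \<and> s h' \<noteq> 0 \<and> t k' \<noteq> 0}"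
  have sub: "?I \<subseteq> {(h, k)}"
  proof (clarify)
    fix h' k' assume I: "(h', k') \<in> composable G" "gmult G h' k' = gmult G h k" "s h' \<noteq> 0"
    have "h' \<in> U" using s I by blast
    moreover have "grng G h' = grng G h" using rng_mult[OF c] rng_mult[OF I(1)] I(2) by simp
    ultimately have "h' = h" using U h by (auto dest: inj_onD)
    then show "h' = h \<and> k' = k" using cancel[OF c] cancel[OF I(1)] I(2) by simp
  qed
  have "conv G s t (gmult G h k) = (\<Sum>(h, k) \<in> {(h, k)}. s h * t k)"
    unfolding conv_def using sub c by (intro sum.mono_neutral_left) auto
  then show ?thesis by simp
qed

end

lemma conv_outside_mult_sets:
  assumes "\<And>h. h \<notin> U \<Longrightarrow> s h = 0" "\<And>k. k \<notin> V \<Longrightarrow> t k = 0" "g \<notin> mult_sets G U V"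
  shows "conv G s t g = 0"
  unfolding conv_def
proof (rule sum.neutral, safe)
  fix h k assume "(h, k) \<in> composable G" "g = gmult G h k" "s h \<noteq> 0"
  then show "s h * t k = 0" using assms by (auto simp: mult_sets_def)
qed

text \<open>The completion only knows products of elements of the convolution algebra, and reading off a value
  of an iterated product requires the partial products to stay in that algebra. For functions supported
  in local bisections this holds because the factors of an arrow \<open>g\<close> of the product set
  are found continuously: the first one from the range of \<open>g\<close> and the second one from its
  domain.\<close>
lemma (in etale_groupoid) conv_in_Cc:
  assumes U: "local_bisection G U" and V: "local_bisection G V"
    and s: "s \<in> Cc G U" and t: "t \<in> Cc G V"
  shows "conv G s t \<in> Cc G (mult_sets G U V)"
proof -
  let ?T = "topo G"
  let ?U0 = "subtopology ?T (units G)"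
  let ?M = "mult_sets G U V"
  let ?X = "subtopology ?T ?M"
  have s0: "\<And>h. h \<notin> U \<Longrightarrow> s h = 0" and t0: "\<And>k. k \<notin> V \<Longrightarrow> t k = 0"
    using s t by (auto simp: Cc_def)
  have inj: "inj_on (grng G) U" using U by (simp add: local_bisection_def)
  have out: "conv G s t g = 0" if "g \<notin> ?M" for g
    using conv_outside_mult_sets s0 t0 that by metis
  have UV: "U \<subseteq> arrows G" "V \<subseteq> arrows G"
    using U V openin_subset by (auto simp: local_bisection_def)
  have M: "?M \<subseteq> arrows G" using mult_closed by (auto simp: mult_sets_def)
  have hU: "homeomorphic_map (subtopology ?T U) (subtopology ?U0 (grng G ` U)) (grng G)"
    using U unfolding local_bisection_def
    by (intro homeomorphic_map_open_injective[OF continuous_grng open_map_grng]) blast+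
  then obtain \<rho> where \<rho>: "homeomorphic_maps (subtopology ?T U) (subtopology ?U0 (grng G ` U)) (grng G) \<rho>"
    using homeomorphic_map_maps by blast
  have \<rho>r: "\<rho> (grng G h) = h" if "h \<in> U" for h
    using \<rho> that UV by (auto simp: homeomorphic_maps_def)
  \<comment> \<open>The sections \<open>\<rho>\<close> and \<open>\<delta>\<close> return the first and the second factor.\<close>
  obtain \<delta> where \<delta>: "homeomorphic_maps (subtopology ?T V) (subtopology ?U0 (gdom G ` V)) (gdom G) \<delta>"
    using local_bisection_homeomorphic[OF V] homeomorphic_map_maps by blast
  have \<delta>d: "\<delta> (gdom G k) = k" if "k \<in> V" for k
    using \<delta> that UV by (auto simp: homeomorphic_maps_def)
  have cr: "continuous_map ?X (subtopology ?U0 (grng G ` U)) (grng G)"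
    using continuous_grng rng_mult
    by (intro continuous_map_into_subtopology[of _ ?U0] continuous_map_from_subtopology)
      (auto simp: mult_sets_def)
  have cd: "continuous_map ?X (subtopology ?U0 (gdom G ` V)) (gdom G)"
    using continuous_gdom dom_mult
    by (intro continuous_map_into_subtopology[of _ ?U0] continuous_map_from_subtopology)
      (auto simp: mult_sets_def)
  have c1: "continuous_map ?X euclidean (\<lambda>g. s (\<rho> (grng G g)))"
    using continuous_map_compose[OF cr continuous_map_compose[of _ _ \<rho> euclidean s]] \<rho> s
    by (auto simp: homeomorphic_maps_def Cc_def o_def)
  have c2: "continuous_map ?X euclidean (\<lambda>g. t (\<delta> (gdom G g)))"
    using continuous_map_compose[OF cd continuous_map_compose[of _ _ \<delta> euclidean t]] \<delta> t
    by (auto simp: homeomorphic_maps_def Cc_def o_def)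
  have "continuous_map ?X (prod_topology euclidean euclidean) (\<lambda>g. (s (\<rho> (grng G g)), t (\<delta> (gdom G g))))"
    using c1 c2 unfolding continuous_map_pairwise by (simp add: o_def)
  then have "continuous_map ?X euclidean (\<lambda>g. (s (\<rho> (grng G g)), t (\<delta> (gdom G g))))"
    by (simp add: euclidean_product_topology)
  moreover have "continuous_map (euclidean :: (complex \<times> complex) topology) euclidean (\<lambda>p. fst p * snd p)"
    by (auto intro!: continuous_intros)
  ultimately have "continuous_map ?X euclidean (\<lambda>g. s (\<rho> (grng G g)) * t (\<delta> (gdom G g)))"
    by (auto dest: continuous_map_compose simp del: continuous_map_iff_continuous2 simp: o_def)
  then have cont: "continuous_map ?X euclidean (conv G s t)"
  proof (rule continuous_map_eq)
    fix g assume "g \<in> topspace ?X"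
    then obtain h k where "h \<in> U" "k \<in> V" "(h, k) \<in> composable G" "g = gmult G h k"
      by (auto simp: mult_sets_def)
    then show "s (\<rho> (grng G g)) * t (\<delta> (gdom G g)) = conv G s t g"
      using conv_gmult[OF inj s0] rng_mult dom_mult \<rho>r \<delta>d by simp
  qed
  obtain K where K: "compactin ?T K" "{g. s g \<noteq> 0} \<subseteq> K" "K \<subseteq> U" using s by (auto simp: Cc_def)
  obtain L where L: "compactin ?T L" "{g. t g \<noteq> 0} \<subseteq> L" "L \<subseteq> V" using t by (auto simp: Cc_def)
  have "g \<in> mult_sets G K L" if "conv G s t g \<noteq> 0" for g
    using conv_outside_mult_sets[of K s L t g] K L that by blast
  moreover have "mult_sets G K L \<subseteq> ?M" using K(3) L(3) unfolding mult_sets_def by blast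
  ultimately show ?thesis
    using out cont compactin_mult_sets[OF K(1) L(1)] by (auto simp: Cc_def)
qed

section \<open>Evaluation on a compatible completion\<close>

lemma continuous_eq_on_dense:
  fixes f h :: "'a::topological_space \<Rightarrow> 'b::t2_space"
  assumes D: "closure D = UNIV" and f: "continuous_on UNIV f" and h: "continuous_on UNIV h"
    and eq: "\<And>x. x \<in> D \<Longrightarrow> f x = h x"
  shows "f = h"
proof -
  have "closure D \<subseteq> {x. f x = h x}"
    using eq closed_Collect_eq[OF f h] by (intro closure_minimal) auto
  then show ?thesis using D by auto
qed

lemma Cc_subset_conv_algebra: "local_bisection G U \<Longrightarrow> Cc G U \<subseteq> conv_algebra G"
  unfolding conv_algebra_def by (rule subset_trans[OF _ fspace.span_superset]) blast

lemma conv_algebra_add: "s \<in> conv_algebra G \<Longrightarrow> t \<in> conv_algebra G \<Longrightarrow> s + t \<in> conv_algebra G"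
  unfolding conv_algebra_def by (rule fspace.span_add)

lemma conv_algebra_fscale: "s \<in> conv_algebra G \<Longrightarrow> fscale c s \<in> conv_algebra G"
  unfolding conv_algebra_def by (rule fspace.span_scale)

lemma bounded_range_Cc:
  assumes "s \<in> Cc G U"
  shows "bounded (range s)"
proof -
  obtain K where K: "compactin (topo G) K" "{g. s g \<noteq> 0} \<subseteq> K" "K \<subseteq> U"
    using assms by (auto simp: Cc_def)
  then have "compactin (subtopology (topo G) U) K" by (simp add: compactin_subtopology)
  then have "compactin euclidean (s ` K)"
    using assms by (intro image_compactin) (auto simp: Cc_def)
  then have "bounded (insert 0 (s ` K))" using compact_imp_bounded by auto
  moreover have "range s \<subseteq> insert 0 (s ` K)" using K(2) by blast
  ultimately show ?thesis using bounded_subset by blast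
qed

text \<open>Since \<open>sup_norm\<close> is a supremum of reals, it dominates pointwise values only for bounded
  functions.\<close>
lemma bounded_range_conv_algebra:
  assumes "s \<in> conv_algebra G"
  shows "bounded (range s)"
proof -
  have "fspace.subspace {s :: 'a \<Rightarrow> complex. bounded (range s)}"
  proof (rule fspace.subspaceI, safe)
    fix s t :: "'a \<Rightarrow> complex" assume "bounded (range s)" "bounded (range t)"
    then obtain b c where "\<And>g. norm (s g) \<le> b" "\<And>g. norm (t g) \<le> c"
      unfolding bounded_iff by auto
    then have "norm ((s + t) g) \<le> b + c" for g
      using norm_triangle_ineq[of "s g" "t g"] by (simp add: add_mono order_trans)
    then show "bounded (range (s + t))" unfolding bounded_iff by auto
  next
    fix c and s :: "'a \<Rightarrow> complex" assume "bounded (range s)"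
    then obtain b where "\<And>g. norm (s g) \<le> b" unfolding bounded_iff by auto
    then have "norm (fscale c s g) \<le> norm c * b" for g
      by (simp add: fscale_def norm_mult mult_left_mono)
    then show "bounded (range (fscale c s))" unfolding bounded_iff by auto
  qed (auto simp: zero_fun_def)
  then have "conv_algebra G \<subseteq> {s. bounded (range s)}"
    unfolding conv_algebra_def using bounded_range_Cc by (intro fspace.span_minimal) auto
  then show ?thesis using assms by blast
qed

lemma cmod_le_sup_norm: "s \<in> conv_algebra G \<Longrightarrow> cmod (s g) \<le> sup_norm s"
  unfolding sup_norm_def
proof (rule cSUP_upper)
  assume "s \<in> conv_algebra G"
  then obtain b where "\<And>g. norm (s g) \<le> b"
    using bounded_range_conv_algebra unfolding bounded_iff by blast
  then show "bdd_above (range (\<lambda>g. cmod (s g)))" by (rule bdd_aboveI2)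
qed simp

locale compatible = etale_groupoid G
  for G :: "'g groupoid" +
  fixes N :: "('g \<Rightarrow> complex) \<Rightarrow> real" and \<iota> :: "('g \<Rightarrow> complex) \<Rightarrow> 'a::cstar_algebra"
  assumes compatible: "compatible_completion G N \<iota>"
begin

abbreviation eval :: "'g \<Rightarrow> 'a \<Rightarrow> complex" where "eval \<equiv> eval_at G \<iota>"

lemma iota_add: "s \<in> conv_algebra G \<Longrightarrow> t \<in> conv_algebra G \<Longrightarrow> \<iota> (s + t) = \<iota> s + \<iota> t"
  and iota_conv: "s \<in> conv_algebra G \<Longrightarrow> t \<in> conv_algebra G \<Longrightarrow> \<iota> (conv G s t) = \<iota> s * \<iota> t"
  and iota_fscale: "s \<in> conv_algebra G \<Longrightarrow> \<iota> (fscale c s) = scaleC c (\<iota> s)"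
  and iota_norm: "s \<in> conv_algebra G \<Longrightarrow> norm (\<iota> s) = N s"
  and iota_dense: "closure (\<iota> ` conv_algebra G) = UNIV"
  using compatible unfolding compatible_completion_def cstar_completion_def by simp_all

lemma cmod_le_norm_iota: "s \<in> conv_algebra G \<Longrightarrow> cmod (s g) \<le> norm (\<iota> s)"
proof -
  assume s: "s \<in> conv_algebra G"
  have "cmod (s g) \<le> sup_norm s" using s by (rule cmod_le_sup_norm)
  also have "\<dots> \<le> N s"
    using compatible s unfolding compatible_completion_def compatible_norm_def by blast
  finally show ?thesis using iota_norm[OF s] by simp
qed

lemma cmod_diff_le_norm_iota:
  assumes "s \<in> conv_algebra G" "t \<in> conv_algebra G"
  shows "cmod (s g - t g) \<le> norm (\<iota> s - \<iota> t)"
proof -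
  have m: "s - t \<in> conv_algebra G"
    using assms unfolding conv_algebra_def by (rule fspace.span_diff)
  have "\<iota> s = \<iota> (s - t) + \<iota> t" using iota_add[OF m assms(2)] by simp
  then show ?thesis using cmod_le_norm_iota[OF m, of g] by simp
qed

text \<open>The value at \<open>g\<close> is a contraction from the dense image of the convolution algebra to the
  complex numbers, because \<open>cmod (s g) \<le> sup_norm s \<le> N s\<close>. It extends
  uniquely, and linearity passes to the closure one argument at a time.\<close>
lemma eval_exists_unique:
  "\<exists>!f. Vector_Spaces.linear scaleC (*) f \<and> continuous_on UNIV f \<and>
     (\<forall>s \<in> conv_algebra G. f (\<iota> s) = s g)"
proof (rule ex_ex1I)
  let ?C = "conv_algebra G"
  define e where "e x = inv_into ?C \<iota> x g" for x
  have e: "e (\<iota> s) = s g" if "s \<in> ?C" for s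
  proof -
    let ?t = "inv_into ?C \<iota> (\<iota> s)"
    have "?t \<in> ?C" "\<iota> ?t = \<iota> s" using that by (simp_all add: inv_into_into f_inv_into_f)
    then show ?thesis using cmod_diff_le_norm_iota[of ?t s g] that by (simp add: e_def)
  qed
  have "uniformly_continuous_on (\<iota> ` ?C) e"
    unfolding uniformly_continuous_on_def
  proof (intro allI impI exI conjI ballI)
    fix d :: real and x y assume "0 < d" "x \<in> \<iota> ` ?C" "y \<in> \<iota> ` ?C" "dist y x < d"
    then obtain s t where "s \<in> ?C" "t \<in> ?C" "x = \<iota> s" "y = \<iota> t" by blast
    then show "dist (e y) (e x) < d"
      using cmod_diff_le_norm_iota[of t s g] e \<open>dist y x < d\<close> by (simp add: dist_norm)
  qed
  then obtain f where f: "uniformly_continuous_on UNIV f" "\<And>x. x \<in> \<iota> ` ?C \<Longrightarrow> e x = f x"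
    using uniformly_continuous_on_extension_on_closure iota_dense by metis
  have cont: "continuous_on UNIV f" using f(1) uniformly_continuous_imp_continuous by blast
  have fe: "f (\<iota> s) = s g" if "s \<in> ?C" for s using f(2) e that by force
  have c: "continuous_on UNIV (\<lambda>x. f (h x))" if "continuous_on UNIV h" for h :: "'a \<Rightarrow> 'a"
    using continuous_on_compose2[OF cont that] by simp
  have scale: "f (scaleC k x) = k * f x" for k x
  proof -
    have "(\<lambda>x. f (scaleC k x)) = (\<lambda>x. k * f x)"
    proof (rule continuous_eq_on_dense[OF iota_dense])
      show "continuous_on UNIV (\<lambda>x. f (scaleC k x))"
        by (intro c linear_continuous_on bounded_linear_scaleC)
      show "continuous_on UNIV (\<lambda>x. k * f x)" using cont by (intro continuous_intros)
      fix x assume "x \<in> \<iota> ` ?C"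
      then obtain s where s: "s \<in> ?C" "x = \<iota> s" by blast
      then have "f (scaleC k x) = f (\<iota> (fscale k s))" by (simp add: iota_fscale)
      then show "f (scaleC k x) = k * f x"
        using s by (simp add: fe conv_algebra_fscale) (simp add: fscale_def)
    qed
    then show ?thesis by meson
  qed
  have add_iota: "f (\<iota> s + y) = f (\<iota> s) + f y" if s: "s \<in> ?C" for s y
  proof -
    have "(\<lambda>y. f (\<iota> s + y)) = (\<lambda>y. f (\<iota> s) + f y)"
    proof (rule continuous_eq_on_dense[OF iota_dense])
      show "continuous_on UNIV (\<lambda>y. f (\<iota> s + y))" by (intro c continuous_intros)
      show "continuous_on UNIV (\<lambda>y. f (\<iota> s) + f y)" using cont by (intro continuous_intros)
      fix y assume "y \<in> \<iota> ` ?C"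
      then obtain t where t: "t \<in> ?C" "y = \<iota> t" by blast
      then have "f (\<iota> s + y) = f (\<iota> (s + t))" using s by (simp add: iota_add)
      then show "f (\<iota> s + y) = f (\<iota> s) + f y" using s t by (simp add: fe conv_algebra_add)
    qed
    then show ?thesis by meson
  qed
  have add: "f (x + y) = f x + f y" for x y
  proof -
    have "(\<lambda>x. f (x + y)) = (\<lambda>x. f x + f y)"
    proof (rule continuous_eq_on_dense[OF iota_dense])
      show "continuous_on UNIV (\<lambda>x. f (x + y))" by (intro c continuous_intros)
      show "continuous_on UNIV (\<lambda>x. f x + f y)" using cont by (intro continuous_intros)
    qed (use add_iota in auto)
    then show ?thesis by meson
  qed
  have "Vector_Spaces.linear scaleC (*) f"
    unfolding Vector_Spaces.linear_iff
    using add scale cspace.vector_space_axioms vector_space_over_itself.vector_space_axioms by blast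
  then show "\<exists>f. Vector_Spaces.linear scaleC (*) f \<and> continuous_on UNIV f \<and> (\<forall>s \<in> ?C. f (\<iota> s) = s g)"
    using cont fe by blast
next
  fix f h :: "'a \<Rightarrow> complex"
  assume "Vector_Spaces.linear scaleC (*) f \<and> continuous_on UNIV f \<and> (\<forall>s \<in> conv_algebra G. f (\<iota> s) = s g)"
    and "Vector_Spaces.linear scaleC (*) h \<and> continuous_on UNIV h \<and> (\<forall>s \<in> conv_algebra G. h (\<iota> s) = s g)"
  then show "f = h" by (intro continuous_eq_on_dense[OF iota_dense]) auto
qed

lemma
  shows eval_linear: "Vector_Spaces.linear scaleC (*) (eval g)"
    and continuous_on_eval: "continuous_on UNIV (eval g)"
    and eval_iota: "s \<in> conv_algebra G \<Longrightarrow> eval g (\<iota> s) = s g"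
  using theI'[OF eval_exists_unique, of g] unfolding eval_at_def by simp_all

lemma eval_add: "eval g (x + y) = eval g x + eval g y"
  and eval_scaleC: "eval g (scaleC c x) = c * eval g x"
  using eval_linear[of g] unfolding Vector_Spaces.linear_iff by simp_all

lemma eval_diff: "eval g (x - y) = eval g x - eval g y"
  using eval_add[of g "x - y" y] by simp

lemma eval_zero_on_closed_cspan:
  assumes "\<And>x. x \<in> S \<Longrightarrow> eval g x = 0" and "x \<in> closed_cspan S"
  shows "eval g x = 0"
proof -
  have z: "eval g 0 = 0" using eval_add[of g 0 0] by simp
  have "closed_cspan S \<subseteq> {x. eval g x = 0}"
  proof (rule closed_cspan_minimal)
    show "csubspace {x. eval g x = 0}"
      by (auto simp: cspace.subspace_def eval_add eval_scaleC z)
    show "closed {x. eval g x = 0}"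
      using closed_Collect_eq[OF continuous_on_eval continuous_on_const] .
  qed (use assms(1) in blast)
  then show ?thesis using assms(2) by blast
qed

section \<open>Open supports and the direct image\<close>

lemma eval_assoc_map_eq_0:
  assumes x: "x \<in> assoc_map G \<iota> V" and g: "g \<notin> V"
  shows "eval g x = 0"
  using x unfolding assoc_map_def
proof (rule eval_zero_on_closed_cspan[rotated])
  fix y assume "y \<in> \<Union>{\<iota> ` Cc G U | U. local_bisection G U \<and> U \<subseteq> V}"
  then obtain U s where U: "local_bisection G U" "U \<subseteq> V" "s \<in> Cc G U" "y = \<iota> s" by blast
  then have "s g = 0" using g by (auto simp: Cc_def)
  moreover have "s \<in> conv_algebra G" using U Cc_subset_conv_algebra by blast
  ultimately show "eval g y = 0" using U(4) eval_iota by simp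
qed

lemma open_support_subset:
  assumes "x \<in> assoc_map G \<iota> V"
  shows "open_support G \<iota> x \<subseteq> V"
proof
  fix g assume "g \<in> open_support G \<iota> x"
  then have "g \<in> {g \<in> arrows G. eval g x \<noteq> 0}"
    unfolding open_support_def by (rule subsetD[OF interior_of_subset])
  then show "g \<in> V" using eval_assoc_map_eq_0[OF assms, of g] by (cases "g \<in> V") simp_all
qed

text \<open>The formula for \<open>p\<^sub>!\<close>. The open supports lie in \<open>pl V\<close> because elements of
  \<open>p\<^sup>*(U)\<close> vanish off \<open>U\<close>. The converse is where localizability enters: it
  says that elements whose open support lies in \<open>U\<close> do belong to \<open>p\<^sup>*(U)\<close>.\<close>
lemma left_adjoint_eq_open_supports:
  assumes loc: "\<And>V. openin (topo G) V \<Longrightarrow> assoc_map G \<iota> V = gamma G \<iota> V"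
    and pl: "left_adjoint (Max_quantale :: 'a set quantale_struct) (Omega G) (assoc_map G \<iota>) pl"
    and V: "csubspace V" "closed V"
  shows "pl V = (\<Union>a\<in>V. open_support G \<iota> a)"
proof -
  let ?W = "\<Union>a\<in>V. open_support G \<iota> a"
  have V': "V \<in> carrier (Max_quantale :: 'a set quantale_struct)"
    using V by (simp add: Max_quantale_def)
  then have pV: "openin (topo G) (pl V)" using pl by (auto simp: left_adjoint_def Omega_def)
  have adj: "pl V \<subseteq> U \<longleftrightarrow> V \<subseteq> assoc_map G \<iota> U" if "openin (topo G) U" for U
    using pl V' that by (auto simp: left_adjoint_def Omega_def Max_quantale_def)
  have "?W \<subseteq> pl V"
    using adj[OF pV] open_support_subset by blast
  moreover have W: "openin (topo G) ?W"
    by (intro openin_Union) (auto simp: open_support_def)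
  have "V \<subseteq> gamma G \<iota> ?W"
    unfolding gamma_def by (rule order_trans[OF _ subset_closed_cspan]) blast
  then have "pl V \<subseteq> ?W" using adj[OF W] loc[OF W] by simp
  ultimately show ?thesis by blast
qed

text \<open>The value of a triple product at a product of two arrows, when the middle function is supported
  near a unit. The support of the middle function is allowed to miss that unit, in which case both
  sides vanish; this uniformity is needed because \<open>p\<^sup>*(U)\<close> is generated by functions supported
  in arbitrary local bisections inside \<open>U\<close>.\<close>
lemma eval_iota_triple:
  assumes S: "local_bisection G S" and T: "local_bisection G T" and U: "local_bisection G U"
    and V: "local_bisection G V" "V \<subseteq> U"
    and s: "s \<in> Cc G S" and t: "t \<in> Cc G T" and \<phi>: "\<phi> \<in> Cc G V"
    and h: "h \<in> S" "(h, k) \<in> composable G" "gdom G h \<in> U"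
  shows "eval (gmult G h k) (\<iota> s * \<iota> \<phi> * \<iota> t) = s h * \<phi> (gdom G h) * t k"
proof -
  have ha: "h \<in> arrows G" using h(2) by (auto simp: composable_def)
  have c: "(h, gdom G h) \<in> composable G"
    using ha unit_props[OF gdom_in_units[OF ha]] by (auto simp: composable_def)
  have alg: "s \<in> conv_algebra G" "t \<in> conv_algebra G" "\<phi> \<in> conv_algebra G"
    using s t \<phi> S T V Cc_subset_conv_algebra by blast+
  have sv: "conv G s \<phi> \<in> Cc G (mult_sets G S V)" by (rule conv_in_Cc[OF S V(1) s \<phi>])
  have bSV: "local_bisection G (mult_sets G S V)" by (rule local_bisection_mult_sets[OF S V(1)])
  have algsv: "conv G s \<phi> \<in> conv_algebra G" using Cc_subset_conv_algebra[OF bSV] sv by blast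
  have "conv G (conv G s \<phi>) t \<in> conv_algebra G"
    using Cc_subset_conv_algebra[OF local_bisection_mult_sets[OF bSV T]]
      conv_in_Cc[OF bSV T sv t] by blast
  then have "eval (gmult G h k) (\<iota> s * \<iota> \<phi> * \<iota> t) = conv G (conv G s \<phi>) t (gmult G h k)"
    using alg algsv by (simp add: iota_conv[symmetric] eval_iota)
  \<comment> \<open>The bisection must be \<open>S U\<close> and not \<open>S V\<close>: it has to contain
    \<open>h\<close> also when \<open>gdom G h\<close> is not in \<open>V\<close>.\<close>
  also have "\<dots> = conv G s \<phi> h * t k"
  proof (rule conv_gmult)
    have "local_bisection G (mult_sets G S U)" by (rule local_bisection_mult_sets[OF S U])
    then show "inj_on (grng G) (mult_sets G S U)" by (simp add: local_bisection_def)
    show "conv G s \<phi> g = 0" if "g \<notin> mult_sets G S U" for g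
      using s \<phi> V(2) that by (intro conv_outside_mult_sets[of S _ U]) (auto simp: Cc_def)
    show "h \<in> mult_sets G S U" using c h mult_dom[OF ha] by (force simp: mult_sets_def)
  qed (rule h)
  also have "conv G s \<phi> h = s h * \<phi> (gdom G h)"
  proof -
    have "inj_on (grng G) S" "\<And>g. g \<notin> S \<Longrightarrow> s g = 0"
      using S s by (auto simp: local_bisection_def Cc_def)
    from conv_gmult[OF this c h(1), where t = \<phi>] show ?thesis using mult_dom[OF ha] by simp
  qed
  finally show ?thesis .
qed

text \<open>An element of the algebra may have discontinuous values when the groupoid is not Hausdorff, so its
  nonvanishing set need not be open. It is enough that it contains the nonvanishing set of a single
  function supported in a local bisection.\<close>
lemma open_support_memI:
  assumes U: "local_bisection G U" and s: "s \<in> Cc G U" and g: "s g \<noteq> 0"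
    and y: "\<And>h. s h \<noteq> 0 \<Longrightarrow> eval h y \<noteq> 0"
  shows "g \<in> open_support G \<iota> y"
proof -
  have oU: "openin (topo G) U" using U by (simp add: local_bisection_def)
  have UG: "U \<subseteq> arrows G" using oU by (rule openin_subset)
  have "openin (subtopology (topo G) U) {h \<in> topspace (subtopology (topo G) U). s h \<in> - {0}}"
    using s by (intro openin_continuous_map_preimage[of _ euclidean]) (auto simp: Cc_def)
  moreover have "{h \<in> topspace (subtopology (topo G) U). s h \<in> - {0}} = {h. s h \<noteq> 0}"
    using s UG by (auto simp: Cc_def)
  ultimately have "openin (topo G) {h. s h \<noteq> 0}" using openin_trans_full oU by metis
  moreover have "{h. s h \<noteq> 0} \<subseteq> {h \<in> arrows G. eval h y \<noteq> 0}"
    using s UG y by (auto simp: Cc_def)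
  ultimately have "{h. s h \<noteq> 0} \<subseteq> open_support G \<iota> y"
    unfolding open_support_def by (intro interior_of_maximal)
  then show ?thesis using g by blast
qed

section \<open>Stability forces trivial isotropy\<close>

text \<open>A nontrivial isotropy arrow \<open>g\<close> at \<open>x\<close> factors both as
  \<open>x x g\<close> and as \<open>g x x\<close>. The elements \<open>a\<close> and \<open>b\<close> are chosen
  so that these two contributions cancel in \<open>a \<phi> b\<close> even when neither vanishes. Hence the product
  set \<open>p\<^sub>!(a) U p\<^sub>!(b)\<close> sees \<open>g\<close> while \<open>p\<^sub>!(a p\<^sup>*(U) b)\<close> does not.\<close>
lemma principal_if_stable:
  assumes loc: "\<And>V. openin (topo G) V \<Longrightarrow> assoc_map G \<iota> V = gamma G \<iota> V"
    and stable: "stable_quantic_bundle (Max_quantale :: 'a set quantale_struct) G (assoc_map G \<iota>)"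
  shows "principal_groupoid G"
proof -
  let ?Q = "Max_quantale :: 'a set quantale_struct"
  obtain pl where pl: "left_adjoint ?Q (Omega G) (assoc_map G \<iota>) pl"
    using stable by (auto simp: stable_quantic_bundle_def semiopen_map_def)
  have g_unit: "g = x"
    if x: "x \<in> units G" and g: "g \<in> arrows G" "gdom G g = x" "grng G g = x" for g x
  proof (rule ccontr)
    assume "g \<noteq> x"
    note ux = unit_props[OF x]
    obtain U where U: "local_bisection G U" "x \<in> U" using local_bisection_exists[OF ux(1)] by blast
    obtain W where W: "local_bisection G W" "g \<in> W" using local_bisection_exists[OF g(1)] by blast
    \<comment> \<open>\<open>g\<close> and \<open>x\<close> have the same domain, so no local bisection contains both; they
      need not have disjoint neighbourhoods, though.\<close>
    have "g \<notin> U"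
      using U \<open>g \<noteq> x\<close> g ux by (auto simp: local_bisection_def dest: inj_onD)
    have "x \<notin> W"
      using W \<open>g \<noteq> x\<close> g ux by (auto simp: local_bisection_def dest: inj_onD)
    obtain f where f: "f \<in> Cc G U" "f x = 1" "\<And>h. f h \<in> \<real>"
      using local_bisection_function_exists[OF U] by blast
    obtain s where s: "s \<in> Cc G W" "s g = 1" "\<And>h. s h \<in> \<real>"
      using local_bisection_function_exists[OF W] by blast
    have fg: "f g = 0" and sx: "s x = 0"
      using f(1) s(1) \<open>g \<notin> U\<close> \<open>x \<notin> W\<close> by (auto simp: Cc_def)
    have fC: "f \<in> conv_algebra G" and sC: "s \<in> conv_algebra G"
      using f(1) s(1) Cc_subset_conv_algebra[OF U(1)] Cc_subset_conv_algebra[OF W(1)] by blast+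
    \<comment> \<open>The imaginary unit keeps \<open>f \<plusminus> \<i> s\<close> nonzero wherever
      \<open>f\<close> or \<open>s\<close> is, even where the two supports overlap.\<close>
    define a where "a = \<iota> f + scaleC \<i> (\<iota> s)"
    define b where "b = \<iota> f - scaleC \<i> (\<iota> s)"
    have ea: "eval h a = f h + \<i> * s h" and eb: "eval h b = f h - \<i> * s h" for h
      using fC sC by (simp_all add: a_def b_def eval_add eval_diff eval_scaleC eval_iota)
    have nz: "f h + \<i> * s h \<noteq> 0" "f h - \<i> * s h \<noteq> 0" if "f h \<noteq> 0 \<or> s h \<noteq> 0" for h
      using f(3)[of h] s(3)[of h] that by (auto simp: complex_eq_iff complex_is_Real_iff)
    let ?A = "closed_cspan {a}" and ?B = "closed_cspan {b}"
    let ?gen = "\<Union>{\<iota> ` Cc G V | V. local_bisection G V \<and> V \<subseteq> U}"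
    have A: "csubspace ?A" "closed ?A" and B: "csubspace ?B" "closed ?B"
      by (rule csubspace_closed_cspan closed_closed_cspan)+
    have oU: "openin (topo G) U" using U(1) by (simp add: local_bisection_def)
    define P where "P = qmult ?Q (qmult ?Q ?A (assoc_map G \<iota> U)) ?B"
    \<comment> \<open>Products of closed spans are computed on generators, so it suffices to look at
      \<open>a \<phi> b\<close> for functions \<open>\<phi>\<close> supported in local bisections.\<close>
    have "P = closed_cspan {u * v | u v. u \<in> {y * z | y z. y \<in> {a} \<and> z \<in> ?gen} \<and> v \<in> {b}}"
      unfolding P_def assoc_map_def Max_quantale_def
      by (simp only: quantale_struct.simps closed_cspan_mult)
    then have P: "P = closed_cspan {a * z * b | z. z \<in> ?gen}"
      by (simp add: setcompr_eq_image image_image)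
    have P': "csubspace P" "closed P"
      unfolding P by (rule csubspace_closed_cspan closed_closed_cspan)+
    have "(x, g) \<in> composable G" "(g, x) \<in> composable G" "(x, x) \<in> composable G"
      using g ux by (auto simp: composable_def)
    have gx: "gmult G x g = g" "gmult G g x = g"
      using rng_mult_self[OF g(1)] mult_dom[OF g(1)] g by simp_all
    have "eval g y = 0" if "y \<in> P" for y
      using that unfolding P
    proof (rule eval_zero_on_closed_cspan[rotated])
      fix y assume "y \<in> {a * z * b | z. z \<in> ?gen}"
      then obtain V \<phi> where V: "local_bisection G V" "V \<subseteq> U" "\<phi> \<in> Cc G V"
        and y: "y = a * \<iota> \<phi> * b" by blast
      note triple = eval_iota_triple[OF _ _ U(1) V(1,2) _ _ V(3)]
      have "eval g (\<iota> f * \<iota> \<phi> * \<iota> f) = f x * \<phi> x * f g"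
        using triple[OF U(1) U(1) f(1) f(1) U(2) \<open>(x, g) \<in> composable G\<close>] U(2) ux gx by simp
      moreover have "eval g (\<iota> f * \<iota> \<phi> * \<iota> s) = f x * \<phi> x * s g"
        using triple[OF U(1) W(1) f(1) s(1) U(2) \<open>(x, g) \<in> composable G\<close>] U(2) ux gx by simp
      moreover have "eval g (\<iota> s * \<iota> \<phi> * \<iota> f) = s g * \<phi> x * f x"
        using triple[OF W(1) U(1) s(1) f(1) W(2) \<open>(g, x) \<in> composable G\<close>] U(2) g gx by simp
      moreover have "eval g (\<iota> s * \<iota> \<phi> * \<iota> s) = s g * \<phi> x * s x"
        using triple[OF W(1) W(1) s(1) s(1) W(2) \<open>(g, x) \<in> composable G\<close>] U(2) g gx by simp
      \<comment> \<open>The first and the last term vanish; the mixed ones enter with factors \<open>- \<i>\<close> and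
        \<open>\<i>\<close>.\<close>
      ultimately show "eval g y = 0"
        by (simp add: y a_def b_def distrib_left distrib_right left_diff_distrib right_diff_distrib
            scaleC_mult_left scaleC_mult_right eval_add eval_diff eval_scaleC fg sx f(2) s(2))
    qed
    then have "g \<notin> pl P"
      using interior_of_subset[of "topo G"]
      by (fastforce simp: left_adjoint_eq_open_supports[OF loc pl P'] open_support_def)
    moreover have "g \<in> pl P"
    proof -
      have "pl P = qmult (Omega G) (qmult (Omega G) (pl ?A) U) (pl ?B)"
        using stable pl A B oU unfolding stable_quantic_bundle_def P_def
        by (simp add: Omega_def Max_quantale_def)
      moreover have "a \<in> ?A" "b \<in> ?B" using subset_closed_cspan by blast+
      moreover have "x \<in> open_support G \<iota> a"
        using f(2) nz(1) by (intro open_support_memI[OF U(1) f(1)]) (auto simp: ea)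
      moreover have "g \<in> open_support G \<iota> b"
        using s(2) nz(2) by (intro open_support_memI[OF W(1) s(1)]) (auto simp: eb)
      moreover have "gmult G x x = x" using mult_dom[OF ux(1)] ux by simp
      ultimately have "x \<in> pl ?A" "g \<in> pl ?B" and xx: "gmult G x x = x"
        and plP: "pl P = mult_sets G (mult_sets G (pl ?A) U) (pl ?B)"
        using left_adjoint_eq_open_supports[OF loc pl A] left_adjoint_eq_open_supports[OF loc pl B]
        by (auto simp: Omega_def)
      then have "x \<in> mult_sets G (pl ?A) U"
        using U(2) \<open>(x, x) \<in> composable G\<close> unfolding mult_sets_def by force
      then show ?thesis
        unfolding plP using \<open>g \<in> pl ?B\<close> \<open>(x, g) \<in> composable G\<close> gx(1)
        unfolding mult_sets_def by force
    qed
    ultimately show False by blast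
  qed
  show ?thesis
    unfolding principal_groupoid_def using g_unit unit_props by blast
qed

end

section \<open>From principal to Hausdorff\<close>

text \<open>Arrows with different domains or different ranges are separated by preimages of disjoint open sets
  of units. Distinct arrows \<open>g\<close> and \<open>h\<close> with equal domain and equal range would
  make \<open>g h\<^sup>-\<^sup>1\<close> an isotropy arrow that is not a unit.\<close>
lemma (in etale_groupoid) Hausdorff_if_principal:
  assumes "principal_groupoid G"
  shows "Hausdorff_space (topo G)"
  unfolding Hausdorff_space_def
proof (intro allI impI, elim conjE)
  fix g h assume g: "g \<in> arrows G" and h: "h \<in> arrows G" and ne: "g \<noteq> h"
  have sep: "\<exists>U V. openin (topo G) U \<and> openin (topo G) V \<and> g \<in> U \<and> h \<in> V \<and> disjnt U V"
    if f: "continuous_map (topo G) (subtopology (topo G) (units G)) f" and "f g \<noteq> f h" for f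
  proof -
    let ?Y = "subtopology (topo G) (units G)"
    have "f g \<in> topspace ?Y" "f h \<in> topspace ?Y"
      using f g h continuous_map_image_subset_topspace by blast+
    then obtain U V where UV: "openin ?Y U" "openin ?Y V" "f g \<in> U" "f h \<in> V" "disjnt U V"
      using Hausdorff_units \<open>f g \<noteq> f h\<close> unfolding Hausdorff_space_def by meson
    then have "disjnt {k \<in> arrows G. f k \<in> U} {k \<in> arrows G. f k \<in> V}"
      by (auto simp: disjnt_def)
    then show ?thesis
      using openin_continuous_map_preimage[OF f UV(1)] openin_continuous_map_preimage[OF f UV(2)]
        UV g h by blast
  qed
  have "gdom G g \<noteq> gdom G h \<or> grng G g \<noteq> grng G h"
  proof (rule ccontr)
    assume "\<not> ?thesis"
    then have d: "gdom G g = gdom G h" and r: "grng G g = grng G h" by auto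
    have hi: "ginv G h \<in> arrows G" using h inv_closed by simp
    have c: "(g, ginv G h) \<in> composable G" and c': "(ginv G h, h) \<in> composable G"
      using g h hi d rng_inv dom_inv by (auto simp: composable_def)
    let ?k = "gmult G g (ginv G h)"
    have "?k \<in> arrows G" "gdom G ?k = grng G h" "grng G ?k = grng G h"
      using mult_closed[OF c] dom_mult[OF c] rng_mult[OF c] dom_inv[OF h] r by simp_all
    then have "?k = grng G h"
      using assms grng_in_units[OF h] unfolding principal_groupoid_def by blast
    then have "gmult G ?k h = h" using rng_mult_self[OF h] by simp
    moreover have "gmult G ?k h = gmult G g (gdom G h)"
      using mult_assoc[OF c c'] by (simp add: gdom_def)
    ultimately show False using mult_dom[OF g] d ne by simp
  qed
  then show "\<exists>U V. openin (topo G) U \<and> openin (topo G) V \<and> g \<in> U \<and> h \<in> V \<and> disjnt U V"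
    using sep continuous_gdom continuous_grng by blast
qed

theorem theorem5p10:
  fixes G :: "'g groupoid"
    and N :: "('g \<Rightarrow> complex) \<Rightarrow> real"
    and \<iota> :: "('g \<Rightarrow> complex) \<Rightarrow> 'a::cstar_algebra"
  assumes "etale_groupoid G"
    and "localizable_completion G N \<iota>"
    and "stable_quantic_bundle (Max_quantale :: 'a set quantale_struct) G (assoc_map G \<iota>)"
  shows "Hausdorff_space (topo G) \<and> principal_groupoid G"
proof -
  interpret etale_groupoid G by (rule assms(1))
  interpret compatible G N \<iota>
    using assms(2) by unfold_locales (simp add: localizable_completion_def)
  have "principal_groupoid G"
    using assms(2,3) by (intro principal_if_stable) (simp_all add: localizable_completion_def)
  then show ?thesis using Hausdorff_if_principal by blast
qed

end
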